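(* Consider a symmetric, irreducible, aperiodic random walk on a countable group $\Gamma$. Let $R$ denote the radius of convergence of the Green's function $G_z(x,y)=\sum_{n\ge0}z^np^n(x,y)$, and let $G'_r(x,y)$ be its derivative with respect to $r$. Assume that there exists $\beta>0$ such that for all $x,y\in\Gamma$, $$G'_r(x,y)\sim \frac{C_{x,y}}{(R-r)^\beta}\qquad\text{as } r\uparrow R,$$ for some $C_{x,y}>0$. Then there exist constants $C'_{x,y}>0$ such that for all $x,y\in\Gamma$ $$p^n(x,y)\sim C'_{x,y}R^{-n}n^{\beta-2}\qquad\text{as }n\to\infty .$$
   Context: A (right) random walk on $\Gamma$ is a Markov chain $X_n=x\xi_1\cdots\xi_n$ with $\xi_i$ i.i.d. $\Gamma$-valued; $p^n(x,y)=P^x\{X_n=y\}$. It is symmetric if the law of $\xi_1$ is invariant under $x\mapsto x^{-1}$, irreducible if the semigroup generated by the support of this law is $\Gamma$ (so that the radius of convergence $R$ does not depend on $x,y$), and aperiodic if $\gcd\{n\ge1:p^n(1,1)>0\}=1$. *)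

theory Defs
  imports "HOL-Probability.Probability" "HOL-Algebra.Group" "HOL-Library.Landau_Symbols"
begin

text \<open>
  The increments are indexed by \<open>{1..}\<close>, as in \<open>X\<^sub>n = x \<xi>\<^sub>1 \<dots> \<xi>\<^sub>n\<close>; the value
  of \<open>\<xi> 0\<close> is irrelevant. Independence includes measurability, so every \<open>\<xi> i\<close> with
  \<open>i \<ge> 1\<close> maps \<open>space M\<close> into \<open>carrier \<Gamma>\<close>.
\<close>

locale random_walk = group \<Gamma> + prob_space M
  for \<Gamma> :: "('a, 'b) monoid_scheme" (structure)
    and M :: "'w measure"
    and \<xi> :: "nat \<Rightarrow> 'w \<Rightarrow> 'a" +
  assumes countable_carrier: "countable (carrier \<Gamma>)"
    and indep_increments: "indep_vars (\<lambda>_. count_space (carrier \<Gamma>)) \<xi> {1..}"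
    and identically_distributed:
      "\<And>i. i \<ge> 1 \<Longrightarrow>
        distr M (count_space (carrier \<Gamma>)) (\<xi> i) = distr M (count_space (carrier \<Gamma>)) (\<xi> 1)"

definition step_law :: "('a, 'b) monoid_scheme \<Rightarrow> 'w measure \<Rightarrow> (nat \<Rightarrow> 'w \<Rightarrow> 'a) \<Rightarrow> 'a measure"
  where "step_law \<Gamma> M \<xi> = distr M (count_space (carrier \<Gamma>)) (\<xi> 1)"

primrec walk :: "('a, 'b) monoid_scheme \<Rightarrow> (nat \<Rightarrow> 'w \<Rightarrow> 'a) \<Rightarrow> 'a \<Rightarrow> nat \<Rightarrow> 'w \<Rightarrow> 'a"
  where
    "walk \<Gamma> \<xi> x 0 \<omega> = x"
  | "walk \<Gamma> \<xi> x (Suc n) \<omega> = walk \<Gamma> \<xi> x n \<omega> \<otimes>\<^bsub>\<Gamma>\<^esub> \<xi> (Suc n) \<omega>"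

definition trans_prob ::
    "('a, 'b) monoid_scheme \<Rightarrow> 'w measure \<Rightarrow> (nat \<Rightarrow> 'w \<Rightarrow> 'a) \<Rightarrow> nat \<Rightarrow> 'a \<Rightarrow> 'a \<Rightarrow> real"
  where "trans_prob \<Gamma> M \<xi> n x y = measure M {\<omega> \<in> space M. walk \<Gamma> \<xi> x n \<omega> = y}"

definition symmetric_walk :: "('a, 'b) monoid_scheme \<Rightarrow> 'w measure \<Rightarrow> (nat \<Rightarrow> 'w \<Rightarrow> 'a) \<Rightarrow> bool"
  where "symmetric_walk \<Gamma> M \<xi> \<longleftrightarrow>
    distr (step_law \<Gamma> M \<xi>) (count_space (carrier \<Gamma>)) (m_inv \<Gamma>) = step_law \<Gamma> M \<xi>"

inductive_set semigroup_generated :: "('a, 'b) monoid_scheme \<Rightarrow> 'a set \<Rightarrow> 'a set"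
  for \<Gamma> :: "('a, 'b) monoid_scheme" and S :: "'a set"
  where
    incl: "s \<in> S \<Longrightarrow> s \<in> semigroup_generated \<Gamma> S"
  | mult: "g \<in> semigroup_generated \<Gamma> S \<Longrightarrow> h \<in> semigroup_generated \<Gamma> S \<Longrightarrow>
      g \<otimes>\<^bsub>\<Gamma>\<^esub> h \<in> semigroup_generated \<Gamma> S"

definition irreducible_walk :: "('a, 'b) monoid_scheme \<Rightarrow> 'w measure \<Rightarrow> (nat \<Rightarrow> 'w \<Rightarrow> 'a) \<Rightarrow> bool"
  where "irreducible_walk \<Gamma> M \<xi> \<longleftrightarrow>
    semigroup_generated \<Gamma> {g \<in> carrier \<Gamma>. measure (step_law \<Gamma> M \<xi>) {g} > 0} = carrier \<Gamma>"

definition aperiodic_walk :: "('a, 'b) monoid_scheme \<Rightarrow> 'w measure \<Rightarrow> (nat \<Rightarrow> 'w \<Rightarrow> 'a) \<Rightarrow> bool"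
  where "aperiodic_walk \<Gamma> M \<xi> \<longleftrightarrow>
    Gcd {n::nat. n \<ge> 1 \<and> trans_prob \<Gamma> M \<xi> n \<one>\<^bsub>\<Gamma>\<^esub> \<one>\<^bsub>\<Gamma>\<^esub> > 0} = 1"

definition green ::
    "('a, 'b) monoid_scheme \<Rightarrow> 'w measure \<Rightarrow> (nat \<Rightarrow> 'w \<Rightarrow> 'a) \<Rightarrow> real \<Rightarrow> 'a \<Rightarrow> 'a \<Rightarrow> real"
  where "green \<Gamma> M \<xi> r x y = (\<Sum>n. r ^ n * trans_prob \<Gamma> M \<xi> n x y)"

text \<open>
  For an irreducible walk the radius of convergence of the Green's function does not depend
  on the pair of points, so it is taken at the identity. For a symmetric walk it is a finite
  number, so nothing is lost in the conversion from \<^typ>\<open>ereal\<close> to \<^typ>\<open>real\<close>.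
\<close>

definition green_radius :: "('a, 'b) monoid_scheme \<Rightarrow> 'w measure \<Rightarrow> (nat \<Rightarrow> 'w \<Rightarrow> 'a) \<Rightarrow> real"
  where "green_radius \<Gamma> M \<xi> =
    real_of_ereal (conv_radius (\<lambda>n. trans_prob \<Gamma> M \<xi> n \<one>\<^bsub>\<Gamma>\<^esub> \<one>\<^bsub>\<Gamma>\<^esub>))"

end

theory Submission
  imports Defs "HOL-Real_Asymp.Real_Asymp"
begin

text \<open>
  Put \<open>a\<^sub>n(g) = R\<^sup>n p\<^sup>n(\<one>, g)\<close>. In the variable \<open>s = r / R\<close> the hypothesis says that
  \<open>\<Sum>n. n a\<^sub>n(g) s\<^sup>n\<close> is asymptotic to a positive multiple of \<open>(1 - s) powr - \<beta>\<close> as \<open>s\<close> increases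
  to \<open>1\<close>, and the claim is that \<open>a\<^sub>n(g)\<close> is asymptotic to a positive multiple of
  \<open>n powr (\<beta> - 2)\<close>. Such a transfer from a power series to its coefficients needs a Tauberian
  condition, which is monotonicity here.

  The Tauberian theorem (\<open>monotone_tauberian\<close>) is for coefficients \<open>n D\<^sub>n\<close> with \<open>D\<close> nonnegative and
  decreasing. Its core is Karamata's theorem for continuous test functions
  (\<open>karamata_continuous\<close>), which follows from Weierstrass approximation.

  Monotonicity comes from symmetry. The \<open>a\<^sub>n\<close> are the kernels of the powers of a symmetric operator
  \<open>T\<close>, so by the Cauchy-Schwarz inequality \<open>a\<^sub>2\<^sub>k(\<one>)\<close>, and more generally \<open>a\<^sub>2\<^sub>k(\<one>) + a\<^sub>2\<^sub>k(x)\<close> and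
  \<open>a\<^sub>2\<^sub>k(\<one>) - a\<^sub>2\<^sub>k(x)\<close>, are log-convex in \<open>k\<close>. They are bounded, because the return probabilities are
  supermultiplicative and thus \<open>a\<^sub>n(\<one>) \<le> 1\<close>; a bounded log-convex sequence decreases
  (\<open>polar_decseq\<close>).

  It remains to see that odd times behave like even ones, and this is where aperiodicity enters. The
  ratios \<open>a\<^sub>2\<^sub>k\<^sub>+\<^sub>2(\<one>) / a\<^sub>2\<^sub>k(\<one>)\<close> tend to \<open>1\<close>, as otherwise the \<open>a\<^sub>n(\<one>)\<close> would decay exponentially
  and the power series with coefficients \<open>n a\<^sub>n(\<one>)\<close> would stay bounded near \<open>1\<close>. Hence
  the normalised spectral measure of \<open>T\<^sup>k\<close> applied to the point mass at \<open>\<one>\<close> concentrates near \<open>1\<close>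
  and \<open>- 1\<close>. If \<open>m\<close> is odd and \<open>\<epsilon> = a\<^sub>m(\<one>) > 0\<close>, then \<open>T\<^sup>m - \<epsilon>\<close> has nonnegative entries, and so have
  its powers. Testing with odd powers of \<open>t\<^sup>m - \<epsilon>\<close>, which are much larger in absolute value at
  \<open>- 1\<close> than at \<open>1\<close> and negative there, excludes mass near \<open>- 1\<close>. So
  \<open>a\<^sub>2\<^sub>k\<^sub>+\<^sub>1(\<one>) / a\<^sub>2\<^sub>k(\<one>)\<close> tends to \<open>1\<close> (\<open>odd_ratio_tendsto\<close>), and by Cauchy-Schwarz
  \<open>a\<^sub>2\<^sub>k(x) - a\<^sub>2\<^sub>k\<^sub>+\<^sub>1(x)\<close> is \<open>o(a\<^sub>2\<^sub>k(\<one>))\<close> for every \<open>x\<close>. The argument only manipulates moments and kernels;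
  no spectral theorem is needed.
\<close>

section \<open>Karamata's theorem with continuous test functions\<close>

text \<open>
  The unnormalised mean of \<open>g (exp (- T))\<close> for a Gamma distributed \<open>T\<close> with shape \<open>\<beta>\<close>; the
  total mass is \<open>Gamma \<beta>\<close>, which is also the value at \<open>g = 1\<close>.
\<close>

definition gamma_mean :: "real \<Rightarrow> (real \<Rightarrow> real) \<Rightarrow> real" where
  "gamma_mean \<beta> g = integral {0..} (\<lambda>t. g (exp (- t)) * (t powr (\<beta> - 1) / exp t))"

lemma gamma_mean_absolutely_integrable:
  fixes g :: "real \<Rightarrow> real"
  assumes \<beta>: "\<beta> > 0" and g: "continuous_on {0..1} g"
  shows "(\<lambda>t. g (exp (- t)) * (t powr (\<beta> - 1) / exp t)) absolutely_integrable_on {0..}"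
proof (rule absolutely_integrable_bounded_measurable_product_real)
  have c: "continuous_on {0..} (\<lambda>t. g (exp (- t)))"
    by (rule continuous_on_compose2[OF g]) (auto intro!: continuous_intros)
  show "(\<lambda>t. g (exp (- t))) \<in> borel_measurable (lebesgue_on {0..})"
    using c by (intro continuous_imp_measurable_on_sets_lebesgue) auto
  have "bounded (g ` {0..1})"
    using g by (intro compact_imp_bounded compact_continuous_image) auto
  moreover have "(\<lambda>t. g (exp (- t))) ` {0..} \<subseteq> g ` {0..1}"
    by auto
  ultimately show "bounded ((\<lambda>t. g (exp (- t))) ` {0..})"
    by (rule bounded_subset)
  show "(\<lambda>t. t powr (\<beta> - 1) / exp t) absolutely_integrable_on {0..}"
    using Gamma_integral_real[OF \<beta>]
    by (intro nonnegative_absolutely_integrable_1) (auto simp: has_integral_iff)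
qed auto

lemma gamma_mean_integrable:
  fixes g :: "real \<Rightarrow> real"
  assumes "\<beta> > 0" "continuous_on {0..1} g"
  shows "(\<lambda>t. g (exp (- t)) * (t powr (\<beta> - 1) / exp t)) integrable_on {0..}"
  by (rule set_lebesgue_integral_eq_integral(1)[OF gamma_mean_absolutely_integrable[OF assms]])

lemma gamma_mean_mono:
  assumes "\<beta> > 0" "continuous_on {0..1} f" "continuous_on {0..1} g"
    and "\<And>x. x \<in> {0..1} \<Longrightarrow> f x \<le> g x"
  shows "gamma_mean \<beta> f \<le> gamma_mean \<beta> g"
  unfolding gamma_mean_def
  using assms by (intro integral_le gamma_mean_integrable mult_right_mono) auto

lemma gamma_mean_sum:
  assumes "\<beta> > 0" "finite I" "\<And>i. i \<in> I \<Longrightarrow> continuous_on {0..1} (f i)"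
  shows "gamma_mean \<beta> (\<lambda>x. \<Sum>i\<in>I. a i * f i x) = (\<Sum>i\<in>I. a i * gamma_mean \<beta> (f i))"
proof -
  have "integral {0..} (\<lambda>t. \<Sum>i\<in>I. a i * (f i (exp (- t)) * (t powr (\<beta> - 1) / exp t)))
      = (\<Sum>i\<in>I. a i * gamma_mean \<beta> (f i))"
    unfolding gamma_mean_def using assms
    by (subst integral_sum) (auto intro!: integrable_on_mult_right gamma_mean_integrable simp del: times_divide_eq_right)
  then show ?thesis
    by (simp add: gamma_mean_def sum_distrib_left sum_divide_distrib mult_ac)
qed

lemma gamma_mean_power:
  assumes \<beta>: "\<beta> > 0"
  shows "gamma_mean \<beta> (\<lambda>x. x ^ k) = Gamma \<beta> / (real k + 1) powr \<beta>"
proof -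
  define c :: real where "c = real k + 1"
  have c: "c > 0" by (simp add: c_def)
  define F where "F = (\<lambda>t::real. t powr (\<beta> - 1) / exp t)"
  have img: "(*) c ` {0..} = {0..}"
    using c by (auto simp: image_def intro!: bexI[of _ "_ / c"])
  have "F absolutely_integrable_on {0..} \<and> integral {0..} F = Gamma \<beta>"
    using Gamma_integral_real[OF \<beta>] unfolding F_def
    by (auto simp: has_integral_iff intro!: nonnegative_absolutely_integrable_1)
  then have "integral {0..} (\<lambda>t. \<bar>c\<bar> *\<^sub>R F (c * t)) = Gamma \<beta>"
    using has_absolute_integral_change_of_variables_real
        [of "{0..}" "(*) c" "\<lambda>_. c" F "Gamma \<beta>"] c img
    by (auto intro!: derivative_eq_intros simp: inj_on_def)
  also have "(\<lambda>t. \<bar>c\<bar> *\<^sub>R F (c * t))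
      = (\<lambda>t. c powr \<beta> * (F (c * t) * c powr (1 - \<beta>)))"
    using c by (simp add: fun_eq_iff powr_diff)
  also have "integral {0..} \<dots> = c powr \<beta> * integral {0..} (\<lambda>t. F (c * t) * c powr (1 - \<beta>))"
    by simp
  also have "integral {0..} (\<lambda>t. F (c * t) * c powr (1 - \<beta>)) = gamma_mean \<beta> (\<lambda>x. x ^ k)"
    unfolding gamma_mean_def
  proof (rule integral_cong)
    fix t :: real assume t: "t \<in> {0..}"
    have "exp (c * t) = exp t * exp t ^ k"
      by (simp add: c_def distrib_right exp_add exp_of_nat_mult)
    moreover have "(c * t) powr (\<beta> - 1) * c powr (1 - \<beta>) = t powr (\<beta> - 1)"
      using c t by (simp add: powr_mult powr_diff field_simps)
    ultimately show "F (c * t) * c powr (1 - \<beta>) = exp (- t) ^ k * (t powr (\<beta> - 1) / exp t)"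
      by (simp add: F_def exp_minus divide_simps power_inverse)
  qed
  finally show ?thesis using c by (simp add: c_def field_simps)
qed

lemma gamma_mean_one: "\<beta> > 0 \<Longrightarrow> gamma_mean \<beta> (\<lambda>_. 1) = Gamma \<beta>"
  using gamma_mean_power[of \<beta> 0] by simp

lemma one_minus_power_ratio_tendsto:
  "((\<lambda>s::real. (1 - s) / (1 - s ^ Suc i)) \<longlongrightarrow> 1 / (real i + 1)) (at_left 1)"
proof -
  have "((\<lambda>s::real. 1 / (\<Sum>j\<le>i. s ^ j)) \<longlongrightarrow> 1 / (\<Sum>j\<le>i. 1 ^ j)) (at_left 1)"
    by (intro tendsto_intros) auto
  moreover have "\<forall>\<^sub>F s::real in at_left 1. 1 / (\<Sum>j\<le>i. s ^ j) = (1 - s) / (1 - s ^ Suc i)"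
    using eventually_at_left_real[of 0 "1::real"]
  proof (rule eventually_mono)
    fix s :: real assume s: "s \<in> {0<..<1}"
    have "1 - s ^ Suc i = (1 - s) * (\<Sum>j\<le>i. s ^ j)"
      by (metis lessThan_Suc_atMost one_diff_power_eq)
    then show "1 / (\<Sum>j\<le>i. s ^ j) = (1 - s) / (1 - s ^ Suc i)"
      using s by auto
  qed auto
  ultimately show ?thesis
    by (subst tendsto_cong[symmetric]) (auto simp: add.commute)
qed

text \<open>
  Monomials are the case in which the limit is immediate: inserting \<open>x ^ i\<close> into the sum amounts to
  evaluating the power series at \<open>s ^ Suc i\<close>.
\<close>

lemma karamata_power:
  fixes c :: "nat \<Rightarrow> real"
  assumes lim: "((\<lambda>s. (1 - s) powr \<beta> * (\<Sum>n. c n * s ^ n)) \<longlongrightarrow> K) (at_left 1)"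
  shows "((\<lambda>s. (1 - s) powr \<beta> * (\<Sum>n. c n * s ^ n * (s ^ n) ^ i))
           \<longlongrightarrow> K / (real i + 1) powr \<beta>) (at_left 1)"
proof -
  define A where "A = (\<lambda>s. \<Sum>n. c n * s ^ n)"
  have f: "filterlim (\<lambda>s::real. s ^ Suc i) (at_left 1) (at_left 1)"
  proof (rule filterlim_at_withinI)
    have "((\<lambda>s::real. s ^ Suc i) \<longlongrightarrow> 1 ^ Suc i) (at_left 1)" by (intro tendsto_intros)
    then show "((\<lambda>s::real. s ^ Suc i) \<longlongrightarrow> 1) (at_left 1)" by simp
    have "\<forall>\<^sub>F s::real in at_left 1. s \<in> {0<..<1}" by (rule eventually_at_left_real) auto
    then show "\<forall>\<^sub>F s::real in at_left 1. s ^ Suc i \<in> {..<1} - {1}"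
      by eventually_elim (auto intro: power_Suc_less_one simp del: power_Suc)
  qed
  have 1: "((\<lambda>s. (1 - s ^ Suc i) powr \<beta> * A (s ^ Suc i)) \<longlongrightarrow> K) (at_left 1)"
    using filterlim_compose[OF lim f] by (simp add: A_def o_def)
  have 2: "((\<lambda>s. ((1 - s) / (1 - s ^ Suc i)) powr \<beta>) \<longlongrightarrow> (1 / (real i + 1)) powr \<beta>) (at_left 1)"
    by (intro tendsto_powr one_minus_power_ratio_tendsto tendsto_const) auto
  have "((\<lambda>s. ((1 - s) / (1 - s ^ Suc i)) powr \<beta> * ((1 - s ^ Suc i) powr \<beta> * A (s ^ Suc i)))
      \<longlongrightarrow> (1 / (real i + 1)) powr \<beta> * K) (at_left 1)"
    by (rule tendsto_mult[OF 2 1])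
  moreover have "\<forall>\<^sub>F s in at_left 1.
     ((1 - s) / (1 - s ^ Suc i)) powr \<beta> * ((1 - s ^ Suc i) powr \<beta> * A (s ^ Suc i))
     = (1 - s) powr \<beta> * (\<Sum>n. c n * s ^ n * (s ^ n) ^ i)"
    using eventually_at_left_real[of 0 "1::real"]
  proof (rule eventually_mono)
    fix s :: real assume s: "s \<in> {0<..<1}"
    then have "s ^ Suc i < 1" by (intro power_Suc_less_one) auto
    then have "((1 - s) / (1 - s ^ Suc i)) powr \<beta> * (1 - s ^ Suc i) powr \<beta> = (1 - s) powr \<beta>"
      using s by (subst powr_mult[symmetric]) auto
    moreover have "A (s ^ Suc i) = (\<Sum>n. c n * s ^ n * (s ^ n) ^ i)"
      by (simp add: A_def power_mult_distrib mult.assoc flip: power_mult)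
         (simp add: mult.commute)
    ultimately show "((1 - s) / (1 - s ^ Suc i)) powr \<beta> * ((1 - s ^ Suc i) powr \<beta> * A (s ^ Suc i))
     = (1 - s) powr \<beta> * (\<Sum>n. c n * s ^ n * (s ^ n) ^ i)"
      by (metis mult.assoc)
  qed auto
  ultimately have "((\<lambda>s. (1 - s) powr \<beta> * (\<Sum>n. c n * s ^ n * (s ^ n) ^ i))
      \<longlongrightarrow> (1 / (real i + 1)) powr \<beta> * K) (at_left 1)"
    by (rule Lim_transform_eventually)
  then show ?thesis by (simp add: powr_divide)
qed

lemma summable_mult_bounded:
  fixes c h :: "nat \<Rightarrow> real"
  assumes "summable c" "\<And>n. 0 \<le> c n" "\<And>n. \<bar>h n\<bar> \<le> B"
  shows "summable (\<lambda>n. c n * h n)"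
proof (rule summable_comparison_test'[where N = 0])
  show "summable (\<lambda>n. B * c n)" using assms(1) by (rule summable_mult)
  show "norm (c n * h n) \<le> B * c n" for n
    using mult_left_mono[OF assms(3)[of n] assms(2)[of n]] assms(2)
    by (simp add: abs_mult mult.commute)
qed

lemma power_unit_interval: "s \<in> {0<..<1} \<Longrightarrow> (s::real) ^ n \<in> {0..1}"
  by (auto simp: power_le_one)

text \<open>
  Weierstrass approximation passes from monomials to continuous test functions, since the error of
  a uniform approximation is controlled by the sum with test function \<open>1\<close>.
\<close>

theorem karamata_continuous:
  fixes c :: "nat \<Rightarrow> real" and g :: "real \<Rightarrow> real"
  assumes \<beta>: "\<beta> > 0"
    and c: "\<And>n. c n \<ge> 0"
    and summ: "\<And>s. s \<in> {0<..<1} \<Longrightarrow> summable (\<lambda>n. c n * s ^ n)"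
    and lim: "((\<lambda>s. (1 - s) powr \<beta> * (\<Sum>n. c n * s ^ n)) \<longlongrightarrow> K) (at_left 1)"
    and g: "continuous_on {0..1} g"
  shows "((\<lambda>s. (1 - s) powr \<beta> * (\<Sum>n. c n * s ^ n * g (s ^ n)))
           \<longlongrightarrow> K / Gamma \<beta> * gamma_mean \<beta> g) (at_left 1)"
proof (rule tendstoI)
  fix \<epsilon> :: real assume \<epsilon>: "\<epsilon> > 0"
  define \<Phi> where "\<Phi> = (\<lambda>f s. (1 - s) powr \<beta> * (\<Sum>n. c n * s ^ n * f (s ^ n)))"
  have near: "\<forall>\<^sub>F s in at_left 1. s \<in> {0<..<1::real}" by (rule eventually_at_left_real) auto
  have G: "Gamma \<beta> > 0" using \<beta> by (rule Gamma_real_pos)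
  have K: "K \<ge> 0"
  proof (rule tendsto_lowerbound[OF lim])
    show "\<forall>\<^sub>F s in at_left 1. 0 \<le> (1 - s) powr \<beta> * (\<Sum>n. c n * s ^ n)"
      using near by eventually_elim (auto intro!: mult_nonneg_nonneg suminf_nonneg summ c)
  qed auto
  define e where "e = \<epsilon> / (2 * K + 3)"
  have e: "e > 0" using \<epsilon> K by (simp add: e_def)
  obtain p where p: "real_polynomial_function p" and gp: "\<And>x. x \<in> {0..1} \<Longrightarrow> \<bar>g x - p x\<bar> < e"
    using Stone_Weierstrass_real_polynomial_function[OF compact_Icc g e] by blast
  obtain a N where p_eq: "p = (\<lambda>x. \<Sum>i\<le>N. a i * x ^ i)"
    using p unfolding real_polynomial_function_iff_sum by blast
  have pc: "continuous_on {0..1} p"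
    unfolding p_eq by (intro continuous_intros)
  have bdd: "\<exists>B. \<forall>x\<in>{0..1}. \<bar>f x\<bar> \<le> B" if "continuous_on {0..1} f" for f :: "real \<Rightarrow> real"
    using compact_imp_bounded[OF compact_continuous_image[OF that]]
    by (auto simp: bounded_iff)
  have summ': "summable (\<lambda>n. c n * s ^ n * f (s ^ n))"
    if s: "s \<in> {0<..<1}" and f: "continuous_on {0..1} f" for s and f :: "real \<Rightarrow> real"
  proof -
    obtain B where "\<And>x. x \<in> {0..1} \<Longrightarrow> \<bar>f x\<bar> \<le> B" using bdd[OF f] by blast
    then show ?thesis
      using s c power_unit_interval[OF s]
      by (intro summable_mult_bounded[OF summ[OF s], where B = B]) auto
  qed
  have p_lim: "(\<Phi> p \<longlongrightarrow> K / Gamma \<beta> * gamma_mean \<beta> p) (at_left 1)"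
  proof -
    have "((\<lambda>s. \<Sum>i\<le>N. a i * ((1 - s) powr \<beta> * (\<Sum>n. c n * s ^ n * (s ^ n) ^ i)))
        \<longlongrightarrow> (\<Sum>i\<le>N. a i * (K / (real i + 1) powr \<beta>))) (at_left 1)"
      by (intro tendsto_sum tendsto_mult tendsto_const karamata_power lim)
    also have "(\<Sum>i\<le>N. a i * (K / (real i + 1) powr \<beta>)) = K / Gamma \<beta> * gamma_mean \<beta> p"
    proof -
      have "gamma_mean \<beta> p = (\<Sum>i\<le>N. a i * (Gamma \<beta> / (real i + 1) powr \<beta>))"
        unfolding p_eq gamma_mean_power[OF \<beta>, symmetric]
        by (rule gamma_mean_sum[OF \<beta>]) (auto intro!: continuous_intros)
      then show ?thesis
        using G by (simp add: sum_distrib_left field_simps)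
    qed
    finally show ?thesis
    proof (rule Lim_transform_eventually)
      show "\<forall>\<^sub>F s in at_left 1.
        (\<Sum>i\<le>N. a i * ((1 - s) powr \<beta> * (\<Sum>n. c n * s ^ n * (s ^ n) ^ i))) = \<Phi> p s"
        using near
      proof eventually_elim
        case (elim s)
        have "(\<Sum>n. c n * s ^ n * p (s ^ n)) = (\<Sum>n. \<Sum>i\<le>N. a i * (c n * s ^ n * (s ^ n) ^ i))"
          by (simp add: p_eq sum_distrib_left mult_ac)
        also have "\<dots> = (\<Sum>i\<le>N. \<Sum>n. a i * (c n * s ^ n * (s ^ n) ^ i))"
          by (intro suminf_sum summable_mult summ' elim continuous_intros)
        also have "\<dots> = (\<Sum>i\<le>N. a i * (\<Sum>n. c n * s ^ n * (s ^ n) ^ i))"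
          by (intro sum.cong refl suminf_mult summ' elim continuous_intros)
        finally show ?case
          by (simp add: \<Phi>_def sum_distrib_left mult_ac)
      qed
    qed
  qed
  have one_lim: "(\<Phi> (\<lambda>_. 1) \<longlongrightarrow> K) (at_left 1)"
    using lim by (simp add: \<Phi>_def)
  have "gamma_mean \<beta> g \<le> gamma_mean \<beta> (\<lambda>x. p x + e * 1)"
    using gp by (intro gamma_mean_mono \<beta> g continuous_intros pc) (force simp: abs_less_iff)
  moreover have "gamma_mean \<beta> (\<lambda>x. p x + (- e) * 1) \<le> gamma_mean \<beta> g"
    using gp by (intro gamma_mean_mono \<beta> g continuous_intros pc) (force simp: abs_less_iff)
  moreover have E: "gamma_mean \<beta> (\<lambda>x. p x + d * 1) = gamma_mean \<beta> p + d * Gamma \<beta>" for d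
    using gamma_mean_sum[OF \<beta>, of "{0, 1::nat}" "\<lambda>i. if i = 0 then p else (\<lambda>_. 1)"
        "\<lambda>i. if i = 0 then 1 else d"] pc gamma_mean_one[OF \<beta>] by auto
  ultimately have "\<bar>gamma_mean \<beta> p - gamma_mean \<beta> g\<bar> \<le> e * Gamma \<beta>"
    unfolding E abs_le_iff by simp
  then have "K / Gamma \<beta> * \<bar>gamma_mean \<beta> p - gamma_mean \<beta> g\<bar> \<le> K / Gamma \<beta> * (e * Gamma \<beta>)"
    using G K by (intro mult_left_mono) auto
  then have M: "\<bar>K / Gamma \<beta> * gamma_mean \<beta> p - K / Gamma \<beta> * gamma_mean \<beta> g\<bar> \<le> K * e"
    using G K unfolding right_diff_distrib[symmetric] abs_mult by simp
  have "\<forall>\<^sub>F s in at_left 1. dist (\<Phi> p s) (K / Gamma \<beta> * gamma_mean \<beta> p) < e"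
    using tendstoD[OF p_lim e] .
  moreover have "\<forall>\<^sub>F s in at_left 1. \<Phi> (\<lambda>_. 1) s < K + 1"
    using order_tendstoD(2)[OF one_lim, of "K + 1"] by simp
  ultimately show "\<forall>\<^sub>F s in at_left 1.
      dist ((1 - s) powr \<beta> * (\<Sum>n. c n * s ^ n * g (s ^ n))) (K / Gamma \<beta> * gamma_mean \<beta> g) < \<epsilon>"
    using near
  proof eventually_elim
    case (elim s)
    have sg: "summable (\<lambda>n. c n * s ^ n * g (s ^ n))" and sp: "summable (\<lambda>n. c n * s ^ n * p (s ^ n))"
      and s1: "summable (\<lambda>n. c n * s ^ n)"
      using summ' g pc elim(3) summ by auto
    have le: "\<bar>c n * s ^ n * (g (s ^ n) - p (s ^ n))\<bar> \<le> e * (c n * s ^ n)" for n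
    proof -
      have "\<bar>c n * s ^ n * (g (s ^ n) - p (s ^ n))\<bar> = (c n * s ^ n) * \<bar>g (s ^ n) - p (s ^ n)\<bar>"
        using c elim(3) by (simp add: abs_mult)
      also have "\<dots> \<le> (c n * s ^ n) * e"
        using c elim(3) gp[OF power_unit_interval[OF elim(3), of n]]
        by (intro mult_left_mono) auto
      finally show ?thesis by (simp only: mult.commute)
    qed
    have "\<bar>\<Sum>n. c n * s ^ n * (g (s ^ n) - p (s ^ n))\<bar> \<le> (\<Sum>n. e * (c n * s ^ n))"
    proof -
      have sa: "summable (\<lambda>n. \<bar>c n * s ^ n * (g (s ^ n) - p (s ^ n))\<bar>)"
        by (rule summable_comparison_test'[OF summable_mult[OF s1, of e], of 0]) (use le in auto)
      have "\<bar>\<Sum>n. c n * s ^ n * (g (s ^ n) - p (s ^ n))\<bar>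
          \<le> (\<Sum>n. \<bar>c n * s ^ n * (g (s ^ n) - p (s ^ n))\<bar>)"
        by (rule summable_rabs[OF sa])
      also have "\<dots> \<le> (\<Sum>n. e * (c n * s ^ n))"
        by (rule suminf_le[OF le sa summable_mult[OF s1]])
      finally show ?thesis .
    qed
    also have "(\<Sum>n. e * (c n * s ^ n)) = e * (\<Sum>n. c n * s ^ n)"
      by (rule suminf_mult[OF s1])
    finally have "(1 - s) powr \<beta> * \<bar>\<Sum>n. c n * s ^ n * (g (s ^ n) - p (s ^ n))\<bar> \<le>
        (1 - s) powr \<beta> * (e * (\<Sum>n. c n * s ^ n))"
      by (intro mult_left_mono) auto
    also have "\<dots> = e * \<Phi> (\<lambda>_. 1) s"
      unfolding \<Phi>_def mult_1_right by (rule mult.left_commute)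
    also have "(\<Sum>n. c n * s ^ n * (g (s ^ n) - p (s ^ n)))
        = (\<Sum>n. c n * s ^ n * g (s ^ n)) - (\<Sum>n. c n * s ^ n * p (s ^ n))"
      using suminf_diff[OF sg sp] by (simp only: right_diff_distrib)
    also have "(1 - s) powr \<beta> * \<bar>\<dots>\<bar> = \<bar>\<Phi> g s - \<Phi> p s\<bar>"
      unfolding \<Phi>_def right_diff_distrib[symmetric] abs_mult by simp
    finally have "\<bar>\<Phi> g s - \<Phi> p s\<bar> \<le> e * \<Phi> (\<lambda>_. 1) s" .
    also have "\<dots> \<le> e * (K + 1)"
      using elim(2) e by (intro mult_left_mono) auto
    finally have "\<bar>\<Phi> g s - K / Gamma \<beta> * gamma_mean \<beta> g\<bar> < e * (K + 1) + e + K * e"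
      using M elim(1) unfolding dist_real_def by linarith
    also have "\<dots> < e * (2 * K + 3)"
      using e by (simp add: algebra_simps)
    also have "\<dots> = \<epsilon>"
      using K by (simp add: e_def)
    finally show ?case by (simp add: \<Phi>_def dist_real_def)
  qed
qed

lemma gamma_mean_pos:
  fixes g :: "real \<Rightarrow> real"
  assumes \<beta>: "\<beta> > 0" and g: "continuous_on {0..1} g" "\<And>x. x \<in> {0..1} \<Longrightarrow> g x \<ge> 0"
    and ab: "0 < a" "a < b" "\<And>t. a < t \<Longrightarrow> t < b \<Longrightarrow> g (exp (- t)) > 0"
  shows "gamma_mean \<beta> g > 0"
proof -
  define F where "F = (\<lambda>t. g (exp (- t)) * (t powr (\<beta> - 1) / exp t))"
  have Fi: "F integrable_on {0..}"
    unfolding F_def by (rule gamma_mean_integrable[OF \<beta> g(1)])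
  have F0: "F t \<ge> 0" if "t \<ge> 0" for t
    using g(2)[of "exp (- t)"] that by (simp add: F_def)
  have cF: "continuous_on {a..b} F"
    unfolding F_def using ab
    by (intro continuous_intros continuous_on_compose2[OF g(1)]) auto
  have "F ((a + b) / 2) > 0"
    using ab(1,2) ab(3)[of "(a + b) / 2"] by (simp add: F_def)
  moreover have "(a + b) / 2 \<in> {a..b}" using ab by auto
  ultimately have "integral {a..b} F \<noteq> 0"
    using integral_eq_0_iff[OF cF ab(2)] F0 ab(1) by fastforce
  moreover have "integral {a..b} F \<ge> 0"
    using F0 ab by (intro integral_nonneg integrable_continuous_real cF) auto
  moreover have "integral {a..b} F \<le> integral {0..} F"
    using F0 ab by (intro integral_subset_le Fi integrable_continuous_real cF) auto
  ultimately show ?thesis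
    by (simp add: gamma_mean_def F_def)
qed

section \<open>A Tauberian theorem for monotone coefficients\<close>

text \<open>
  A continuous bump function; in the variable \<open>t = - ln x\<close> it is positive
  exactly on the interval between \<open>a\<close> and \<open>b\<close>.
\<close>

definition window :: "real \<Rightarrow> real \<Rightarrow> real \<Rightarrow> real" where
  "window a b x = max 0 ((x - exp (- b)) * (exp (- a) - x))"

lemma window_nonneg: "window a b x \<ge> 0"
  by (simp add: window_def)

lemma window_pos: "a < t \<Longrightarrow> t < b \<Longrightarrow> window a b (exp (- t)) > 0"
  by (simp add: window_def less_max_iff_disj)

lemma window_eq_0:
  assumes "a \<le> b" "\<not> (a < t \<and> t < b)"
  shows "window a b (exp (- t)) = 0"
proof -
  have "(exp (- t) - exp (- b)) * (exp (- a) - exp (- t)) \<le> 0"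
  proof (cases "a < t")
    case True
    with assms have "b \<le> t" by simp
    with assms show ?thesis by (intro mult_nonpos_nonneg) auto
  next
    case False
    with assms show ?thesis by (intro mult_nonneg_nonpos) auto
  qed
  then show ?thesis by (simp add: window_def)
qed

lemma continuous_on_window: "continuous_on A (window a b)"
  unfolding window_def by (intro continuous_intros)

text \<open>
  The densities of the Gamma distributions of shapes \<open>\<beta>\<close> and \<open>2\<close> differ by the factor
  \<open>t powr (\<beta> - 2)\<close>, up to normalisation. On a window close to \<open>t = 1\<close> this factor is nearly \<open>1\<close>.
\<close>

lemma gamma_mean_window_compare:
  assumes \<beta>: "\<beta> > 0" and ab: "0 < a" "a < b"
    and near: "\<And>t. a \<le> t \<Longrightarrow> t \<le> b \<Longrightarrow> \<bar>t powr (\<beta> - 2) - 1\<bar> \<le> e"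
  shows "\<bar>gamma_mean \<beta> (window a b) - gamma_mean 2 (window a b)\<bar> \<le> e * gamma_mean 2 (window a b)"
proof -
  define w where "w = (\<lambda>t. window a b (exp (- t)))"
  define F where "F = (\<lambda>\<gamma> t. w t * (t powr (\<gamma> - 1) / exp t))"
  have int: "F \<gamma> integrable_on {0..}" if "\<gamma> > 0" for \<gamma>
    unfolding F_def w_def by (rule gamma_mean_integrable[OF that continuous_on_window])
  have le: "\<bar>F \<beta> t - F 2 t\<bar> \<le> e * F 2 t" if "t \<ge> 0" for t
  proof (cases "a < t \<and> t < b")
    case True
    then have t: "t > 0" using ab by simp
    have "t powr (\<beta> - 1) = t powr (\<beta> - 2) * t powr (2 - 1)"
      by (subst powr_add[symmetric]) simp
    then have "F \<beta> t - F 2 t = (t powr (\<beta> - 2) - 1) * F 2 t"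
      by (simp add: F_def algebra_simps diff_divide_distrib)
    moreover have "F 2 t \<ge> 0"
      by (simp add: F_def w_def window_nonneg)
    ultimately show ?thesis
      using near[of t] True by (auto simp: abs_mult intro!: mult_right_mono)
  next
    case False
    then have "w t = 0" using window_eq_0 ab by (simp add: w_def)
    then show ?thesis by (simp add: F_def)
  qed
  have "norm (integral {0..} (\<lambda>t. F \<beta> t - F 2 t)) \<le> integral {0..} (\<lambda>t. e * F 2 t)"
    using le \<beta> by (intro integral_norm_bound_integral integrable_diff int integrable_on_mult_right) auto
  moreover have "integral {0..} (\<lambda>t. F \<beta> t - F 2 t) = gamma_mean \<beta> (window a b) - gamma_mean 2 (window a b)"
    using integral_diff[OF int[OF \<beta>] int[of 2]] by (simp add: gamma_mean_def F_def w_def)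
  moreover have "integral {0..} (\<lambda>t. e * F 2 t) = e * integral {0..} (F 2)"
    by (rule integral_mult_right)
  moreover have "integral {0..} (F 2) = gamma_mean 2 (window a b)"
    by (simp add: gamma_mean_def F_def w_def)
  ultimately show ?thesis by simp
qed

lemma sum_of_nat_power:
  fixes s :: real
  assumes "\<bar>s\<bar> < 1"
  shows "(\<lambda>n. real n * s ^ n) sums (s / (1 - s)\<^sup>2)"
proof -
  have "(\<lambda>n. s * (real (Suc n) * s ^ n)) sums (s * (1 / (1 - s)\<^sup>2))"
    using geometric_deriv_sums[of s] assms by (intro sums_mult) auto
  then have "(\<lambda>n. real (Suc n) * s ^ Suc n) sums (s / (1 - s)\<^sup>2)"
    by (simp add: mult_ac)
  then show ?thesis by (subst (asm) sums_Suc_iff) simp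
qed

text \<open>
  For \<open>s = exp (- 1 / N)\<close> a window just to the right of \<open>1\<close> only sees indices \<open>n > N\<close>, for which
  \<open>D n \<le> D N\<close>; a window just to the left of \<open>1\<close> only sees \<open>n < N\<close>, for which \<open>D N \<le> D n\<close>.
  So \<open>D N\<close> is bounded from both sides by a quotient of two sums over the same window: one with
  weights \<open>real n * D n\<close>, covered by the hypothesis, the other with weights \<open>real n\<close>, which is
  the case of exponent \<open>2\<close>.
\<close>

theorem monotone_tauberian:
  fixes D :: "nat \<Rightarrow> real"
  assumes \<beta>: "\<beta> > 0"
    and D: "\<And>n. D n \<ge> 0" and mono: "decseq D"
    and lim: "((\<lambda>s. (1 - s) powr \<beta> * (\<Sum>n. real n * D n * s ^ n)) \<longlongrightarrow> K) (at_left 1)"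
  shows "(\<lambda>n. D n * real n powr (2 - \<beta>)) \<longlonglongrightarrow> K / Gamma \<beta>"
proof -
  define s where "s = (\<lambda>N. exp (- (1 / real N)))"
  define X where "X = (\<lambda>g N. (1 - s N) powr \<beta> * (\<Sum>n. real n * D n * s N ^ n * g (s N ^ n)))"
  define Z where "Z = (\<lambda>g N. (1 - s N) powr 2 * (\<Sum>n. real n * s N ^ n * g (s N ^ n)))"
  define y where "y = (\<lambda>N. D N * (1 - s N) powr (\<beta> - 2))"
  define L where "L = K / Gamma \<beta>"
  have summ1: "summable (\<lambda>n. real n * s ^ n)" if "s \<in> {0<..<1}" for s :: real
    using sum_of_nat_power[of s] that by (auto simp: sums_iff)
  have summD: "summable (\<lambda>n. real n * D n * s ^ n)" if "s \<in> {0<..<1}" for s :: real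
  proof -
    have "\<bar>D n\<bar> \<le> D 0" for n using D[of n] decseqD[OF mono, of 0 n] by simp
    then have "summable (\<lambda>n. real n * s ^ n * D n)"
      using that by (intro summable_mult_bounded[OF summ1, where B = "D 0"]) auto
    then show ?thesis by (simp add: mult_ac)
  qed
  have lim2: "((\<lambda>s::real. (1 - s) powr 2 * (\<Sum>n. real n * s ^ n)) \<longlongrightarrow> 1) (at_left 1)"
  proof (rule Lim_transform_eventually)
    show "((\<lambda>s::real. s) \<longlongrightarrow> 1) (at_left 1)" by (rule tendsto_ident_at)
    have "\<forall>\<^sub>F s::real in at_left 1. s \<in> {0<..<1}" by (rule eventually_at_left_real) auto
    then show "\<forall>\<^sub>F s::real in at_left 1. s = (1 - s) powr 2 * (\<Sum>n. real n * s ^ n)"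
    proof eventually_elim
      case (elim s)
      then have "(\<Sum>n. real n * s ^ n) = s / (1 - s)\<^sup>2"
        using sum_of_nat_power[of s] by (auto simp: sums_iff)
      then show ?case using elim by (simp add: powr_numeral)
    qed
  qed
  have s01: "s N \<in> {0<..<1}" if "N > 0" for N
    using that by (auto simp: s_def)
  have s_lim: "filterlim s (at_left 1) sequentially"
    unfolding s_def by real_asymp
  have Xlim: "X g \<longlonglongrightarrow> L * gamma_mean \<beta> g" if g: "continuous_on {0..1} g" for g
    unfolding X_def L_def
    by (rule filterlim_compose[OF karamata_continuous[OF \<beta> _ summD lim g] s_lim]) (use D in auto)
  have Zlim: "Z g \<longlonglongrightarrow> gamma_mean 2 g" if g: "continuous_on {0..1} g" for g
    using filterlim_compose[OF karamata_continuous[OF _ _ summ1 lim2 g] s_lim]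
    by (simp add: Z_def Gamma_numeral)
  have sP: "s N ^ n = exp (- (real n / real N))" for n N
    by (simp add: s_def flip: exp_of_nat_mult)
  have summW: "summable (\<lambda>n. c n * s N ^ n * window a b (s N ^ n))"
    if N: "N > 0" and c: "\<And>n. c n \<ge> 0" "summable (\<lambda>n. c n * s N ^ n)" for c N a b
  proof -
    have "bounded (window a b ` {0..1})"
      by (intro compact_imp_bounded compact_continuous_image continuous_on_window) auto
    then obtain B where "\<And>x. x \<in> {0..1} \<Longrightarrow> \<bar>window a b x\<bar> \<le> B"
      unfolding bounded_iff by (metis image_eqI real_norm_def)
    then show ?thesis
      using s01[OF N] c(1) power_unit_interval[OF s01[OF N]]
      by (intro summable_mult_bounded[OF c(2), where B = B]) auto
  qed
  have yZ: "(1 - s N) powr \<beta> * (\<Sum>n. D N * (real n * s N ^ n * window a b (s N ^ n))) = y N * Z (window a b) N"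
    if N: "N > 0" for N a b
  proof -
    have h: "(1 - s N) powr (\<beta> - 2) * (1 - s N) powr 2 = (1 - s N) powr \<beta>"
      by (subst powr_add[symmetric]) simp
    have "(\<Sum>n. D N * (real n * s N ^ n * window a b (s N ^ n)))
        = D N * (\<Sum>n. real n * s N ^ n * window a b (s N ^ n))"
      by (rule suminf_mult[OF summW[OF N of_nat_0_le_iff summ1[OF s01[OF N]]]])
    then show ?thesis
      unfolding y_def Z_def h[symmetric] by (simp only: mult_ac)
  qed
  have lower: "X (window 1 b) N \<le> y N * Z (window 1 b) N" if N: "N > 0" and b: "1 < b" for N b
  proof -
    have "(\<Sum>n. real n * D n * s N ^ n * window 1 b (s N ^ n))
        \<le> (\<Sum>n. D N * (real n * s N ^ n * window 1 b (s N ^ n)))"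
    proof (intro suminf_le summW summable_mult N summD summ1 s01)
      fix n
      show "real n * D n * s N ^ n * window 1 b (s N ^ n) \<le> D N * (real n * s N ^ n * window 1 b (s N ^ n))"
      proof (cases "1 < real n / real N \<and> real n / real N < b")
        case True
        then have "D n \<le> D N" using N by (intro decseqD[OF mono]) simp
        then have "D n * (real n * s N ^ n * window 1 b (s N ^ n)) \<le> D N * (real n * s N ^ n * window 1 b (s N ^ n))"
          using s01[OF N] window_nonneg by (intro mult_right_mono) auto
        then show ?thesis by (simp add: mult_ac)
      next
        case False
        then have "window 1 b (s N ^ n) = 0"
          unfolding sP using b by (intro window_eq_0) auto
        then show ?thesis by simp
      qed
    qed (use D in auto)
    then show ?thesis
      unfolding yZ[OF N, symmetric] X_def by (intro mult_left_mono) auto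
  qed
  have upper: "y N * Z (window a 1) N \<le> X (window a 1) N" if N: "N > 0" and a: "a < 1" for N a
  proof -
    have "(\<Sum>n. D N * (real n * s N ^ n * window a 1 (s N ^ n)))
        \<le> (\<Sum>n. real n * D n * s N ^ n * window a 1 (s N ^ n))"
    proof (intro suminf_le summW summable_mult N summD summ1 s01)
      fix n
      show "D N * (real n * s N ^ n * window a 1 (s N ^ n)) \<le> real n * D n * s N ^ n * window a 1 (s N ^ n)"
      proof (cases "a < real n / real N \<and> real n / real N < 1")
        case True
        then have "D N \<le> D n" using N by (intro decseqD[OF mono]) simp
        then have "D N * (real n * s N ^ n * window a 1 (s N ^ n)) \<le> D n * (real n * s N ^ n * window a 1 (s N ^ n))"
          using s01[OF N] window_nonneg by (intro mult_right_mono) auto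
        then show ?thesis by (simp add: mult_ac)
      next
        case False
        then have "window a 1 (s N ^ n) = 0"
          unfolding sP using a by (intro window_eq_0) auto
        then show ?thesis by simp
      qed
    qed (use D in auto)
    then show ?thesis
      unfolding yZ[OF N, symmetric] X_def by (intro mult_left_mono) auto
  qed
  have L0: "L \<ge> 0"
  proof -
    have "K \<ge> 0"
    proof (rule tendsto_lowerbound[OF lim])
      have "\<forall>\<^sub>F s::real in at_left 1. s \<in> {0<..<1}" by (rule eventually_at_left_real) auto
      then show "\<forall>\<^sub>F s in at_left 1. 0 \<le> (1 - s) powr \<beta> * (\<Sum>n. real n * D n * s ^ n)"
        by eventually_elim (auto intro!: mult_nonneg_nonneg suminf_nonneg summD D)
    qed auto
    then show ?thesis using Gamma_real_pos[OF \<beta>] by (simp add: L_def)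
  qed
  \<comment> \<open>Both windows shrink to \<open>1\<close> with the tolerance: \<open>\<delta>\<close> is half the radius on which
    \<open>t powr (\<beta> - 2)\<close> stays within \<open>e\<close> of \<open>1\<close>.\<close>
  have ylim: "y \<longlonglongrightarrow> L"
  proof (rule tendstoI)
    fix \<epsilon> :: real assume \<epsilon>: "\<epsilon> > 0"
    define e where "e = \<epsilon> / (L + 1)"
    have e: "e > 0" and eL: "e * L < \<epsilon>" using \<epsilon> L0 by (auto simp: e_def field_simps)
    have "((\<lambda>t::real. t powr (\<beta> - 2)) \<longlongrightarrow> 1 powr (\<beta> - 2)) (nhds 1)"
      by (intro tendsto_intros filterlim_ident) auto
    then have "\<forall>\<^sub>F t in nhds 1. \<bar>t powr (\<beta> - 2) - 1\<bar> < e"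
      using tendstoD[OF _ e] by (fastforce simp: dist_real_def)
    then obtain d where d: "d > 0" and near: "\<And>t. \<bar>t - 1\<bar> < d \<Longrightarrow> \<bar>t powr (\<beta> - 2) - 1\<bar> < e"
      unfolding eventually_nhds_metric dist_real_def by auto
    define \<delta> where "\<delta> = min (d / 2) (1 / 2)"
    have \<delta>: "\<delta> > 0" "\<delta> < 1" "\<delta> < d" using d by (auto simp: \<delta>_def)
    have mean: "\<bar>gamma_mean \<beta> (window a b) - gamma_mean 2 (window a b)\<bar> \<le> e * gamma_mean 2 (window a b)
        \<and> gamma_mean 2 (window a b) > 0" if "a < b" "1 - \<delta> \<le> a" "b \<le> 1 + \<delta>" for a b
    proof
      have "\<bar>t powr (\<beta> - 2) - 1\<bar> \<le> e" if "a \<le> t" "t \<le> b" for t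
        using \<delta> that \<open>1 - \<delta> \<le> a\<close> \<open>b \<le> 1 + \<delta>\<close> by (intro less_imp_le near) auto
      then show "\<bar>gamma_mean \<beta> (window a b) - gamma_mean 2 (window a b)\<bar> \<le> e * gamma_mean 2 (window a b)"
        using that \<delta> by (intro gamma_mean_window_compare[OF \<beta>]) auto
      show "gamma_mean 2 (window a b) > 0"
        using that \<delta> by (intro gamma_mean_pos[of 2 _ a b] continuous_on_window window_nonneg window_pos) auto
    qed
    have pos: "\<forall>\<^sub>F N in sequentially. N > (0::nat)" by (rule eventually_gt_at_top)
    have "\<forall>\<^sub>F N in sequentially. y N > L - \<epsilon>"
    proof -
      let ?w = "window 1 (1 + \<delta>)"
      have M: "gamma_mean 2 ?w > 0" "gamma_mean \<beta> ?w \<ge> (1 - e) * gamma_mean 2 ?w"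
        using mean[of 1 "1 + \<delta>"] \<delta> by (auto simp: abs_le_iff algebra_simps)
      have "(\<lambda>N. X ?w N / Z ?w N) \<longlonglongrightarrow> L * gamma_mean \<beta> ?w / gamma_mean 2 ?w"
        using M by (intro tendsto_divide Xlim Zlim continuous_on_window) auto
      moreover have "L - \<epsilon> < L * gamma_mean \<beta> ?w / gamma_mean 2 ?w"
      proof -
        have "L - \<epsilon> < L * (1 - e)" using eL by (simp add: algebra_simps)
        also have "\<dots> \<le> L * (gamma_mean \<beta> ?w / gamma_mean 2 ?w)"
          using M L0 by (intro mult_left_mono) (auto simp: field_simps)
        finally show ?thesis by simp
      qed
      ultimately have "\<forall>\<^sub>F N in sequentially. L - \<epsilon> < X ?w N / Z ?w N"
        by (rule order_tendstoD)
      moreover have "\<forall>\<^sub>F N in sequentially. Z ?w N > 0"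
        using order_tendstoD(1)[OF Zlim[OF continuous_on_window] M(1)] .
      ultimately show ?thesis using pos
      proof eventually_elim
        case (elim N)
        have "X ?w N / Z ?w N \<le> y N"
          using lower[OF elim(3), of "1 + \<delta>"] \<delta> elim(2) by (simp add: divide_le_eq)
        with elim(1) show ?case by simp
      qed
    qed
    moreover have "\<forall>\<^sub>F N in sequentially. y N < L + \<epsilon>"
    proof -
      let ?w = "window (1 - \<delta>) 1"
      have M: "gamma_mean 2 ?w > 0" "gamma_mean \<beta> ?w \<le> (1 + e) * gamma_mean 2 ?w"
        using mean[of "1 - \<delta>" 1] \<delta> by (auto simp: abs_le_iff algebra_simps)
      have "(\<lambda>N. X ?w N / Z ?w N) \<longlonglongrightarrow> L * gamma_mean \<beta> ?w / gamma_mean 2 ?w"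
        using M by (intro tendsto_divide Xlim Zlim continuous_on_window) auto
      moreover have "L * gamma_mean \<beta> ?w / gamma_mean 2 ?w < L + \<epsilon>"
      proof -
        have "L * (gamma_mean \<beta> ?w / gamma_mean 2 ?w) \<le> L * (1 + e)"
          using M L0 by (intro mult_left_mono) (auto simp: field_simps)
        also have "\<dots> < L + \<epsilon>" using eL by (simp add: algebra_simps)
        finally show ?thesis by simp
      qed
      ultimately have "\<forall>\<^sub>F N in sequentially. X ?w N / Z ?w N < L + \<epsilon>"
        by (rule order_tendstoD)
      moreover have "\<forall>\<^sub>F N in sequentially. Z ?w N > 0"
        using order_tendstoD(1)[OF Zlim[OF continuous_on_window] M(1)] .
      ultimately show ?thesis using pos
      proof eventually_elim
        case (elim N)
        have "y N \<le> X ?w N / Z ?w N"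
          using upper[OF elim(3), of "1 - \<delta>"] \<delta> elim(2) by (simp add: le_divide_eq)
        with elim(1) show ?case by simp
      qed
    qed
    ultimately show "\<forall>\<^sub>F N in sequentially. dist (y N) L < \<epsilon>"
      by eventually_elim (auto simp: dist_real_def abs_less_iff)
  qed
  have "(\<lambda>N. real N * (1 - s N)) \<longlonglongrightarrow> 1"
    unfolding s_def by real_asymp
  then have "(\<lambda>N. (real N * (1 - s N)) powr (2 - \<beta>)) \<longlonglongrightarrow> 1 powr (2 - \<beta>)"
    by (intro tendsto_powr tendsto_const) auto
  then have "(\<lambda>N. y N * (real N * (1 - s N)) powr (2 - \<beta>)) \<longlonglongrightarrow> L * 1 powr (2 - \<beta>)"
    by (intro tendsto_mult ylim)
  moreover have "\<forall>\<^sub>F N in sequentially. y N * (real N * (1 - s N)) powr (2 - \<beta>) = D N * real N powr (2 - \<beta>)"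
    using eventually_gt_at_top[of 0]
  proof eventually_elim
    case (elim N)
    have "(1 - s N) powr (\<beta> - 2) * (1 - s N) powr (2 - \<beta>) = 1"
      using s01[OF elim] by (simp flip: powr_add)
    then show ?case
      using s01[OF elim] by (simp add: y_def powr_mult mult_ac)
  qed
  ultimately show ?thesis
    unfolding L_def by (auto intro: Lim_transform_eventually)
qed

section \<open>Symmetric convolution semigroups on a group\<close>

lemma has_sum_Cauchy_Schwarz:
  fixes f g :: "'a \<Rightarrow> real"
  assumes ff: "((\<lambda>x. f x * f x) has_sum A) X"
    and fg: "((\<lambda>x. f x * g x) has_sum B) X"
    and gg: "((\<lambda>x. g x * g x) has_sum C) X"
  shows "B\<^sup>2 \<le> A * C"
proof -
  \<comment> \<open>The quadratic form is evaluated at \<open>(- B, A)\<close> when \<open>A\<close> is positive; when \<open>A = 0\<close> it is affine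
    in its first variable and nonnegative, which forces \<open>B = 0\<close>.\<close>
  have quad: "0 \<le> p\<^sup>2 * A + 2 * p * q * B + q\<^sup>2 * C" for p q
  proof -
    have "((\<lambda>x. p\<^sup>2 * (f x * f x) + 2 * p * q * (f x * g x) + q\<^sup>2 * (g x * g x))
        has_sum (p\<^sup>2 * A + 2 * p * q * B + q\<^sup>2 * C)) X"
      by (intro has_sum_add has_sum_cmult_right ff fg gg)
    then have "((\<lambda>x. (p * f x + q * g x)\<^sup>2) has_sum (p\<^sup>2 * A + 2 * p * q * B + q\<^sup>2 * C)) X"
      by (simp add: power2_eq_square algebra_simps)
    then show ?thesis by (rule has_sum_nonneg) simp
  qed
  have A: "A \<ge> 0" using quad[of 1 0] by simp
  show ?thesis
  proof (cases "A = 0")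
    case True
    have "B = 0"
    proof (rule ccontr)
      assume "B \<noteq> 0"
      then show False
        using quad[of "- (C + 1) / (2 * B)" 1] True by (simp add: field_simps)
    qed
    then show ?thesis using True by simp
  next
    case False
    have "0 \<le> A * (A * C - B\<^sup>2)"
      using quad[of "- B" A] by (simp add: power2_eq_square algebra_simps)
    then show ?thesis using A False by (simp add: zero_le_mult_iff)
  qed
qed

lemma has_sum_ge_term:
  fixes f :: "'a \<Rightarrow> real"
  assumes "(f has_sum S) X" "x \<in> X" "\<And>y. y \<in> X \<Longrightarrow> f y \<ge> 0"
  shows "f x \<le> S"
  using has_sum_mono2[OF has_sum_finite[of "{x}" f] assms(1)] assms(2,3) by simp

text \<open>
  A log-convex sequence that increases once grows geometrically from there on.
\<close>

lemma bounded_log_convex_decseq: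
  fixes h :: "nat \<Rightarrow> real"
  assumes nonneg: "\<And>n. h n \<ge> 0" and bound: "\<And>n. h n \<le> B"
    and lc: "\<And>n. (h (Suc n))\<^sup>2 \<le> h n * h (Suc (Suc n))"
  shows "decseq h"
proof (rule decseq_SucI, rule ccontr)
  fix n assume "\<not> h (Suc n) \<le> h n"
  then have gt: "h (Suc n) > h n" by simp
  have pos: "h n > 0"
  proof (rule ccontr)
    assume "\<not> h n > 0"
    then have "h n = 0" using nonneg[of n] by simp
    then show False using lc[of n] gt by simp
  qed
  define r where "r = h (Suc n) / h n"
  have r: "r > 1" using gt pos by (simp add: r_def)
  have step: "h (n + k) > 0 \<and> h (Suc (n + k)) \<ge> r * h (n + k)" for k
  proof (induction k)
    case 0
    then show ?case using pos by (simp add: r_def)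
  next
    case (Suc k)
    then have 1: "h (n + k) > 0" and 2: "r * h (n + k) \<le> h (Suc (n + k))" by auto
    have 3: "h (Suc (n + k)) > 0" using 1 2 r by (smt (verit) mult_pos_pos)
    have "h (n + k) * (r * h (Suc (n + k))) \<le> h (Suc (n + k)) * h (Suc (n + k))"
      using mult_right_mono[OF 2, of "h (Suc (n + k))"] 3 by (simp add: mult_ac)
    also have "\<dots> \<le> h (n + k) * h (Suc (Suc (n + k)))"
      using lc[of "n + k"] by (simp add: power2_eq_square)
    finally show ?case using 1 3 by simp
  qed
  have pow: "r ^ k * h n \<le> h (n + k)" for k
  proof (induction k)
    case (Suc k)
    have "r * (r ^ k * h n) \<le> r * h (n + k)" using Suc r by (intro mult_left_mono) auto
    also have "\<dots> \<le> h (n + Suc k)" using step[of k] by simp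
    finally show ?case by simp
  qed simp
  obtain k where "B / h n < r ^ k" using real_arch_pow[OF r] by blast
  then have "B < r ^ k * h n" using pos by (simp add: divide_less_eq)
  then show False using pow[of k] bound[of "n + k"] by simp
qed

lemma tendsto_mult_diff_zero:
  fixes u v \<rho> :: "nat \<Rightarrow> real"
  assumes uv: "(\<lambda>n. u n - v n) \<longlonglongrightarrow> 0" and v: "Bseq v" and \<rho>: "\<rho> \<longlonglongrightarrow> 1"
  shows "(\<lambda>n. u n * \<rho> n - v n) \<longlonglongrightarrow> 0"
proof -
  have "(\<lambda>n. \<rho> n - 1) \<longlonglongrightarrow> 1 - 1" by (intro tendsto_intros \<rho>)
  then have "Zfun (\<lambda>n. \<rho> n - 1) sequentially" by (simp add: tendsto_Zfun_iff)
  then have "Zfun (\<lambda>n. (\<rho> n - 1) * v n) sequentially"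
    using v by (rule bounded_bilinear.Zfun_prod_Bfun[OF bounded_bilinear_mult])
  then have 1: "(\<lambda>n. (\<rho> n - 1) * v n) \<longlonglongrightarrow> 0" by (simp add: tendsto_Zfun_iff)
  have "(\<lambda>n. (u n - v n) * \<rho> n + (\<rho> n - 1) * v n) \<longlonglongrightarrow> 0 * 1 + 0"
    by (intro tendsto_intros uv \<rho> 1)
  then show ?thesis by (simp add: algebra_simps)
qed

text \<open>
  A discrete semigroup of symmetric nonnegative convolution kernels. In the application
  \<open>a n g = R ^ n * p\<^sup>n(\<one>, g)\<close>, so the \<open>a n (inv x \<otimes> y)\<close> are the entries of the powers of a
  symmetric operator \<open>T\<close>, the transition operator multiplied by \<open>R\<close>. The explanations below are in
  terms of \<open>T\<close> and of the point mass \<open>\<delta>\<close> at \<open>\<one>\<close>.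
\<close>

locale symmetric_convolution = group G
  for G :: "('a, 'b) monoid_scheme" (structure) +
  fixes a :: "nat \<Rightarrow> 'a \<Rightarrow> real"
  assumes nonneg: "x \<in> carrier G \<Longrightarrow> a n x \<ge> 0"
    and convolution: "x \<in> carrier G \<Longrightarrow>
          ((\<lambda>y. a i y * a j (inv y \<otimes> x)) has_sum a (i + j) x) (carrier G)"
    and symmetric: "x \<in> carrier G \<Longrightarrow> a n (inv x) = a n x"
begin

text \<open>
  The functions \<open>\<lambda>y. a i (inv z \<otimes> y)\<close> are the vectors \<open>T ^ i\<close> applied to the point mass at \<open>z\<close>, and
  this lemma computes their inner products. The quadratic inequalities below are instances of the
  Cauchy-Schwarz inequality for finite linear combinations of such vectors.
\<close>

lemma pairing:
  assumes z: "z \<in> carrier G" and w: "w \<in> carrier G"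
  shows "((\<lambda>y. a i (inv z \<otimes> y) * a j (inv w \<otimes> y)) has_sum a (i + j) (inv z \<otimes> w)) (carrier G)"
proof -
  have "((\<lambda>y. a i y * a j (inv y \<otimes> (inv z \<otimes> w))) has_sum a (i + j) (inv z \<otimes> w)) (carrier G)"
    using z w by (intro convolution) auto
  also have "?this \<longleftrightarrow> ?thesis"
  proof (rule has_sum_reindex_bij_witness[of _ "\<lambda>y. inv z \<otimes> y" "\<lambda>y. z \<otimes> y"])
    fix y assume y: "y \<in> carrier G"
    have "inv (inv w \<otimes> (z \<otimes> y)) = inv y \<otimes> (inv z \<otimes> w)"
      using y z w by (simp add: inv_mult_group m_assoc)
    then have "a j (inv w \<otimes> (z \<otimes> y)) = a j (inv y \<otimes> (inv z \<otimes> w))"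
      using symmetric[of "inv w \<otimes> (z \<otimes> y)" j] y z w by simp
    then show "a i (inv z \<otimes> (z \<otimes> y)) * a j (inv w \<otimes> (z \<otimes> y)) = a i y * a j (inv y \<otimes> (inv z \<otimes> w))"
      using y z by (simp flip: m_assoc)
  qed (use z in \<open>auto simp flip: m_assoc\<close>)
  finally show ?thesis .
qed

lemma pairing_one: "((\<lambda>y. a i y * a j y) has_sum a (i + j) \<one>) (carrier G)"
proof -
  have "((\<lambda>y. a i (inv \<one> \<otimes> y) * a j (inv \<one> \<otimes> y)) has_sum a (i + j) (inv \<one> \<otimes> \<one>)) (carrier G)"
    by (intro pairing) auto
  then show ?thesis by (subst (asm) has_sum_cong) auto
qed

lemma cross_pairing:
  assumes x: "x \<in> carrier G"
  shows "((\<lambda>y. a i y * a j (inv x \<otimes> y)) has_sum a (i + j) x) (carrier G)"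
  using pairing[OF one_closed x, of i j] x by (subst (asm) has_sum_cong) auto

lemma shifted_pairing:
  assumes x: "x \<in> carrier G"
  shows "((\<lambda>y. a i (inv x \<otimes> y) * a j (inv x \<otimes> y)) has_sum a (i + j) \<one>) (carrier G)"
  using pairing[OF x x, of i j] x by simp

lemma return_log_convex: "(a (i + j) \<one>)\<^sup>2 \<le> a (i + i) \<one> * a (j + j) \<one>"
  by (rule has_sum_Cauchy_Schwarz[OF pairing_one pairing_one pairing_one])

lemma return_supermult: "a i \<one> * a j \<one> \<le> a (i + j) \<one>"
proof -
  have "a i \<one> * a j (inv \<one> \<otimes> \<one>) \<le> a (i + j) \<one>"
    by (rule has_sum_ge_term[OF convolution]) (auto intro!: mult_nonneg_nonneg nonneg)
  then show ?thesis by simp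
qed

lemma return_power_le: "(a m \<one>) ^ Suc k \<le> a (Suc k * m) \<one>"
proof (induction k)
  case (Suc k)
  have "(a m \<one>) ^ Suc (Suc k) \<le> a m \<one> * a (Suc k * m) \<one>"
    using Suc by (simp add: mult_left_mono nonneg)
  also have "\<dots> \<le> a (m + Suc k * m) \<one>" by (rule return_supermult)
  finally show ?case by simp
qed simp

text \<open>
  Polarisation: for \<open>\<sigma> = 1\<close> and \<open>\<sigma> = - 1\<close> the point masses at \<open>\<one>\<close> and \<open>x\<close> are combined with sign
  \<open>\<sigma>\<close>. This writes the off-diagonal entries of \<open>T ^ n\<close> as differences of values of its quadratic form.
\<close>

lemma polar_pairing:
  assumes x: "x \<in> carrier G" and \<sigma>: "\<sigma> * \<sigma> = 1"
  shows "((\<lambda>y. (a i y + \<sigma> * a i (inv x \<otimes> y)) * (a j y + \<sigma> * a j (inv x \<otimes> y)))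
           has_sum 2 * (a (i + j) \<one> + \<sigma> * a (i + j) x)) (carrier G)"
proof -
  have "((\<lambda>y. a i y * a j y + (\<sigma> * (a i y * a j (inv x \<otimes> y)) + (\<sigma> * (a j y * a i (inv x \<otimes> y))
          + a i (inv x \<otimes> y) * a j (inv x \<otimes> y))))
        has_sum a (i + j) \<one> + (\<sigma> * a (i + j) x + (\<sigma> * a (j + i) x + a (i + j) \<one>))) (carrier G)"
    by (intro has_sum_add has_sum_cmult_right cross_pairing shifted_pairing x pairing_one)
  moreover have "a i y * a j y + (\<sigma> * (a i y * a j (inv x \<otimes> y)) + (\<sigma> * (a j y * a i (inv x \<otimes> y))
          + a i (inv x \<otimes> y) * a j (inv x \<otimes> y)))
      = (a i y + \<sigma> * a i (inv x \<otimes> y)) * (a j y + \<sigma> * a j (inv x \<otimes> y))" for y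
  proof -
    have "(a i y + \<sigma> * a i (inv x \<otimes> y)) * (a j y + \<sigma> * a j (inv x \<otimes> y))
      = a i y * a j y + (\<sigma> * (a i y * a j (inv x \<otimes> y)) + (\<sigma> * (a j y * a i (inv x \<otimes> y))
          + (\<sigma> * \<sigma>) * (a i (inv x \<otimes> y) * a j (inv x \<otimes> y))))"
      by (simp only: distrib_left distrib_right mult_ac add_ac)
    then show ?thesis using \<sigma> by simp
  qed
  ultimately show ?thesis by (simp add: add.commute[of j i] algebra_simps)
qed

lemma polar_nonneg:
  assumes "x \<in> carrier G" "\<sigma> * \<sigma> = 1"
  shows "0 \<le> a (n + n) \<one> + \<sigma> * a (n + n) x"
  using has_sum_nonneg[OF polar_pairing[OF assms, of n n]] by simp

lemma even_le_return: "x \<in> carrier G \<Longrightarrow> a (n + n) x \<le> a (n + n) \<one>"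
  using polar_nonneg[of x "-1" n] by simp

lemma polar_log_convex:
  assumes "x \<in> carrier G" "\<sigma> * \<sigma> = 1"
  shows "(a (i + j) \<one> + \<sigma> * a (i + j) x)\<^sup>2
    \<le> (a (i + i) \<one> + \<sigma> * a (i + i) x) * (a (j + j) \<one> + \<sigma> * a (j + j) x)"
proof -
  have halve: "X\<^sup>2 \<le> A * C" if "(2 * X)\<^sup>2 \<le> (2 * A) * (2 * C)" for X A C :: real
    using that by (simp add: power2_eq_square)
  show ?thesis
    by (rule halve, rule has_sum_Cauchy_Schwarz) (rule polar_pairing[OF assms])+
qed

text \<open>
  The right-hand side is the squared norm of \<open>T ^ k \<delta> - T ^ (k + 1) \<delta>\<close> times that of
  \<open>T ^ k \<delta>\<close>. It is small relative to \<open>(a (2 * k) \<one>)\<^sup>2\<close> once the return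
  sequence has consecutive ratios tending to \<open>1\<close>.
\<close>

lemma parity_gap:
  assumes x: "x \<in> carrier G"
  shows "(a (2 * k) x - a (2 * k + 1) x)\<^sup>2
    \<le> a (2 * k) \<one> * (a (2 * k) \<one> - 2 * a (2 * k + 1) \<one> + a (2 * k + 2) \<one>)"
proof -
  let ?g = "\<lambda>y. a k (inv x \<otimes> y) + (-1) * a (k + 1) (inv x \<otimes> y)"
  have "((\<lambda>y. a k y * a k (inv x \<otimes> y) + (-1) * (a k y * a (k + 1) (inv x \<otimes> y)))
      has_sum a (k + k) x + (-1) * a (k + (k + 1)) x) (carrier G)"
    by (intro has_sum_add has_sum_cmult_right cross_pairing x)
  then have fg: "((\<lambda>y. a k y * ?g y) has_sum a (k + k) x + (-1) * a (k + (k + 1)) x) (carrier G)"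
    by (simp add: algebra_simps)
  have "((\<lambda>y. a k (inv x \<otimes> y) * a k (inv x \<otimes> y) + ((-2) * (a k (inv x \<otimes> y) * a (k + 1) (inv x \<otimes> y))
        + a (k + 1) (inv x \<otimes> y) * a (k + 1) (inv x \<otimes> y)))
      has_sum a (k + k) \<one> + ((-2) * a (k + (k + 1)) \<one> + a ((k + 1) + (k + 1)) \<one>)) (carrier G)"
    by (intro has_sum_add has_sum_cmult_right shifted_pairing x)
  then have gg: "((\<lambda>y. ?g y * ?g y)
      has_sum a (k + k) \<one> + ((-2) * a (k + (k + 1)) \<one> + a ((k + 1) + (k + 1)) \<one>)) (carrier G)"
    by (simp add: algebra_simps)
  have eqs: "k + k = 2 * k" "k + (k + 1) = 2 * k + 1" "k + 1 + (k + 1) = 2 * k + 2" by auto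
  have alg: "p + -1 * q = p - q" "p + (-2 * q + r) = p - 2 * q + r" for p q r :: real
    by simp_all
  show ?thesis
    using has_sum_Cauchy_Schwarz[OF pairing_one fg gg, unfolded eqs]
    unfolding alg .
qed

lemma return_two_step_gap:
  "(a (2 * n + 3) \<one> - a (2 * n + 1) \<one>)\<^sup>2
    \<le> a (2 * n + 2) \<one> * (a (2 * n + 4) \<one> - 2 * a (2 * n + 2) \<one> + a (2 * n) \<one>)"
proof -
  let ?g = "\<lambda>y. a (n + 2) y + (-1) * a n y"
  have "((\<lambda>y. a (n + 1) y * a (n + 2) y + (-1) * (a (n + 1) y * a n y))
      has_sum a ((n + 1) + (n + 2)) \<one> + (-1) * a ((n + 1) + n) \<one>) (carrier G)"
    by (intro has_sum_add has_sum_cmult_right pairing_one)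
  then have fg: "((\<lambda>y. a (n + 1) y * ?g y)
      has_sum a ((n + 1) + (n + 2)) \<one> + (-1) * a ((n + 1) + n) \<one>) (carrier G)"
    by (simp add: algebra_simps)
  have "((\<lambda>y. a (n + 2) y * a (n + 2) y + ((-2) * (a (n + 2) y * a n y) + a n y * a n y))
      has_sum a ((n + 2) + (n + 2)) \<one> + ((-2) * a ((n + 2) + n) \<one> + a (n + n) \<one>)) (carrier G)"
    by (intro has_sum_add has_sum_cmult_right pairing_one)
  then have gg: "((\<lambda>y. ?g y * ?g y)
      has_sum a ((n + 2) + (n + 2)) \<one> + ((-2) * a ((n + 2) + n) \<one> + a (n + n) \<one>)) (carrier G)"
    by (simp add: algebra_simps)
  have eqs: "n + 2 + (n + 2) = 2 * n + 4" "n + 1 + (n + 2) = 2 * n + 3" "n + 2 + n = 2 * n + 2"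
    "n + 1 + (n + 1) = 2 * n + 2" "n + 1 + n = 2 * n + 1" "n + n = 2 * n" by auto
  have alg: "p + -1 * q = p - q" "p + (-2 * q + r) = p - 2 * q + r" for p q r :: real
    by simp_all
  show ?thesis
    using has_sum_Cauchy_Schwarz[OF pairing_one[of "n + 1" "n + 1"] fg gg, unfolded eqs]
    unfolding alg .
qed

end

section \<open>The ratio limit theorem for the return sequence\<close>

text \<open>
  The kernel of \<open>T ^ n * (T ^ m - \<epsilon>) ^ i\<close>, as iterated differences of the sequence of kernels. For
  \<open>\<epsilon> = a m \<one>\<close> the operator \<open>T ^ m - \<epsilon>\<close> still has nonnegative entries, because \<open>\<epsilon>\<close> is its
  diagonal entry before subtraction.
\<close>

primrec thinned :: "(nat \<Rightarrow> 'a \<Rightarrow> real) \<Rightarrow> nat \<Rightarrow> real \<Rightarrow> nat \<Rightarrow> nat \<Rightarrow> 'a \<Rightarrow> real" where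
  "thinned a m \<epsilon> 0 n x = a n x"
| "thinned a m \<epsilon> (Suc i) n x = thinned a m \<epsilon> i (n + m) x - \<epsilon> * thinned a m \<epsilon> i n x"

context symmetric_convolution
begin

lemma thinned_convolution:
  assumes x: "x \<in> carrier G"
  shows "((\<lambda>y. thinned a m \<epsilon> i n y * a k (inv y \<otimes> x)) has_sum thinned a m \<epsilon> i (n + k) x) (carrier G)"
proof (induction i arbitrary: n)
  case 0
  show ?case using convolution[OF x] by simp
next
  case (Suc i)
  have "((\<lambda>y. thinned a m \<epsilon> i (n + m) y * a k (inv y \<otimes> x) + (- \<epsilon>) * (thinned a m \<epsilon> i n y * a k (inv y \<otimes> x)))
     has_sum (thinned a m \<epsilon> i (n + m + k) x + (- \<epsilon>) * thinned a m \<epsilon> i (n + k) x)) (carrier G)"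
    by (intro has_sum_add has_sum_cmult_right Suc.IH)
  then show ?case
    by (simp add: algebra_simps)
qed

lemma thinned_nonneg:
  assumes "x \<in> carrier G"
  shows "thinned a m (a m \<one>) i n x \<ge> 0"
  using assms
proof (induction i arbitrary: n x)
  case 0
  then show ?case by (simp add: nonneg)
next
  case (Suc i)
  have "thinned a m (a m \<one>) i n x * a m (inv x \<otimes> x) \<le> thinned a m (a m \<one>) i (n + m) x"
    by (rule has_sum_ge_term[OF thinned_convolution]) (use Suc in \<open>auto intro!: mult_nonneg_nonneg nonneg\<close>)
  then show ?case using Suc.prems by (simp add: mult.commute)
qed

end

text \<open>
  The return sequence \<open>a n \<one>\<close> is bounded by \<open>1\<close>, some odd time has positive return weight, and
  the last hypothesis excludes exponential decay.
\<close>

locale aperiodic_convolution = symmetric_convolution +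
  fixes m :: nat
  assumes return_le_1: "a n \<one> \<le> 1"
    and odd_m: "odd m" and return_m: "a m \<one> > 0"
    and not_summable: "\<not> summable (\<lambda>n. real n * a n \<one>)"
begin

lemma polar_decseq:
  assumes x: "x \<in> carrier G" and \<sigma>: "\<sigma> * \<sigma> = 1"
  shows "decseq (\<lambda>n. a (2 * n) \<one> + \<sigma> * a (2 * n) x)"
proof (rule bounded_log_convex_decseq[where B = 2])
  fix n
  show "0 \<le> a (2 * n) \<one> + \<sigma> * a (2 * n) x"
    using polar_nonneg[OF x \<sigma>, of n] by (simp add: mult_2)
  have "\<sigma> = 1 \<or> \<sigma> = - 1" using \<sigma> by (simp add: square_eq_1_iff)
  moreover have "0 \<le> a (2 * n) x" "a (2 * n) x \<le> a (2 * n) \<one>" "a (2 * n) \<one> \<le> 1"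
    using even_le_return[OF x, of n] nonneg[OF x] return_le_1 by (simp_all add: mult_2)
  ultimately show "a (2 * n) \<one> + \<sigma> * a (2 * n) x \<le> 2" by auto
  have eqs: "n + Suc (Suc n) = 2 * Suc n" "n + n = 2 * n" "Suc (Suc n) + Suc (Suc n) = 2 * Suc (Suc n)"
    by auto
  show "(a (2 * Suc n) \<one> + \<sigma> * a (2 * Suc n) x)\<^sup>2
      \<le> (a (2 * n) \<one> + \<sigma> * a (2 * n) x) * (a (2 * Suc (Suc n)) \<one> + \<sigma> * a (2 * Suc (Suc n)) x)"
    using polar_log_convex[OF x \<sigma>, of n "Suc (Suc n)"] unfolding eqs .
qed

lemma even_return_decseq: "decseq (\<lambda>n. a (2 * n) \<one>)"
  using polar_decseq[OF one_closed, of 1] by (simp add: decseq_def)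

lemma even_return_pos: "a (2 * n) \<one> > 0"
proof -
  define k where "k = 2 * n + 1"
  have "0 < (a m \<one>) ^ Suc k" using return_m by simp
  also have "\<dots> \<le> a (Suc k * m) \<one>" by (rule return_power_le)
  also have "Suc k * m = 2 * ((n + 1) * m)" by (simp add: k_def)
  also have "a (2 * ((n + 1) * m)) \<one> \<le> a (2 * n) \<one>"
  proof (rule decseqD[OF even_return_decseq])
    have "m \<ge> 1" using odd_m by (cases m) auto
    then show "n \<le> (n + 1) * m" using mult_le_mono2[of 1 m "n + 1"] by simp
  qed
  finally show ?thesis .
qed

lemma odd_le_even_return: "a (2 * n + 1) \<one> \<le> a (2 * n) \<one>"
proof -
  have "(a (n + (n + 1)) \<one>)\<^sup>2 \<le> a (n + n) \<one> * a ((n + 1) + (n + 1)) \<one>"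
    by (rule return_log_convex)
  moreover have "n + (n + 1) = 2 * n + 1" "n + n = 2 * n" "(n + 1) + (n + 1) = 2 * Suc n" by auto
  ultimately have "(a (2 * n + 1) \<one>)\<^sup>2 \<le> a (2 * n) \<one> * a (2 * Suc n) \<one>"
    by metis
  also have "\<dots> \<le> a (2 * n) \<one> * a (2 * n) \<one>"
    by (intro mult_left_mono decseqD[OF even_return_decseq] nonneg) auto
  finally have "(a (2 * n + 1) \<one>)\<^sup>2 \<le> (a (2 * n) \<one>)\<^sup>2" by (simp add: power2_eq_square)
  then show ?thesis by (rule power2_le_imp_le) (simp add: nonneg)
qed

lemma return_le_even: "a n \<one> \<le> a (2 * (n div 2)) \<one>"
proof (cases "even n")
  case False
  then obtain k where "n = 2 * k + 1" by (elim oddE)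
  then show ?thesis using odd_le_even_return[of k] by simp
qed simp

text \<open>
  The ratio of consecutive terms of the return sequence along even times. By log-convexity it
  increases, and a limit below \<open>1\<close> would mean exponential decay.
\<close>

definition even_ratio :: "nat \<Rightarrow> real" where
  "even_ratio n = a (2 * Suc n) \<one> / a (2 * n) \<one>"

lemma even_ratio_tendsto: "even_ratio \<longlonglongrightarrow> 1"
proof -
  let ?A = "\<lambda>n. a (2 * n) \<one>"
  have inc: "incseq even_ratio"
  proof (rule incseq_SucI)
    fix n
    have eqs: "n + Suc (Suc n) = 2 * Suc n" "n + n = 2 * n" "Suc (Suc n) + Suc (Suc n) = 2 * Suc (Suc n)"
      by auto
    have "(?A (Suc n))\<^sup>2 \<le> ?A n * ?A (Suc (Suc n))"
      using return_log_convex[of n "Suc (Suc n)"] unfolding eqs .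
    then show "even_ratio n \<le> even_ratio (Suc n)"
      using even_return_pos[of n] even_return_pos[of "Suc n"]
      unfolding even_ratio_def by (simp add: divide_simps power2_eq_square mult_ac)
  qed
  have le1: "even_ratio n \<le> 1" for n
    using even_return_pos[of n] decseqD[OF even_return_decseq, of n "Suc n"]
    by (simp add: even_ratio_def)
  obtain l where l: "even_ratio \<longlonglongrightarrow> l" and le_l: "\<And>n. even_ratio n \<le> l"
    using incseq_convergent[OF inc] le1 by blast
  have "l \<le> 1" by (rule LIMSEQ_le_const2[OF l]) (use le1 in blast)
  moreover have "\<not> l < 1"
  proof
    assume "l < 1"
    have "even_ratio 0 > 0" using even_return_pos[of 0] even_return_pos[of 1] by (simp add: even_ratio_def)
    then have l0: "l > 0" using le_l[of 0] by linarith
    define q where "q = sqrt l"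
    have q: "0 < q" "q < 1" "l = q\<^sup>2" using l0 \<open>l < 1\<close> by (auto simp: q_def)
    have geo: "?A n \<le> l ^ n" for n
    proof (induction n)
      case 0
      show ?case using return_le_1[of 0] by simp
    next
      case (Suc n)
      have "?A (Suc n) = even_ratio n * ?A n" using even_return_pos[of n] by (simp add: even_ratio_def)
      also have "\<dots> \<le> l * l ^ n"
        using le_l[of n] Suc l0 even_return_pos[of n] by (intro mult_mono) auto
      finally show ?case by simp
    qed
    have bound: "a n \<one> \<le> q ^ n / q" for n
    proof -
      have "a n \<one> \<le> l ^ (n div 2)" using return_le_even[of n] geo[of "n div 2"] by linarith
      also have "\<dots> = q ^ (2 * (n div 2))" using q(3) by (simp add: power_mult)
      also have "\<dots> \<le> q ^ n / q"
      proof (cases "even n")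
        case True
        then show ?thesis using q by (simp add: field_simps)
      next
        case False
        then obtain k where "n = 2 * k + 1" by (elim oddE)
        then show ?thesis using q by simp
      qed
      finally show ?thesis .
    qed
    have "summable (\<lambda>n. real n * a n \<one>)"
    proof (rule summable_comparison_test'[where N = 0])
      show "summable (\<lambda>n. (real n * q ^ n) / q)"
        using sum_of_nat_power[of q] q by (intro summable_divide) (auto simp: sums_iff)
      show "norm (real n * a n \<one>) \<le> (real n * q ^ n) / q" for n
        using mult_left_mono[OF bound[of n], of "real n"] nonneg[of \<one> n] by simp
    qed
    then show False using not_summable by simp
  qed
  ultimately show ?thesis using l by simp
qed

lemma even_shift_ratio_tendsto: "(\<lambda>n. a (2 * (n + l)) \<one> / a (2 * n) \<one>) \<longlonglongrightarrow> 1"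
proof (induction l)
  case 0
  then show ?case using even_return_pos by (simp add: less_imp_neq[symmetric])
next
  case (Suc l)
  have "(\<lambda>n. even_ratio (n + l)) \<longlonglongrightarrow> 1" by (rule LIMSEQ_ignore_initial_segment[OF even_ratio_tendsto])
  then have "(\<lambda>n. even_ratio (n + l) * (a (2 * (n + l)) \<one> / a (2 * n) \<one>)) \<longlonglongrightarrow> 1 * 1"
    by (intro tendsto_mult Suc)
  moreover have "even_ratio (n + l) * (a (2 * (n + l)) \<one> / a (2 * n) \<one>) = a (2 * (n + Suc l)) \<one> / a (2 * n) \<one>" for n
    using even_return_pos[of "n + l"] by (simp add: even_ratio_def)
  ultimately show ?case by (simp only: mult_1)
qed

text \<open>
  The ratio of the return weight at an odd time to that at the even time before it.
\<close>

definition odd_ratio :: "nat \<Rightarrow> real" where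
  "odd_ratio n = a (2 * n + 1) \<one> / a (2 * n) \<one>"

lemma odd_ratio_bounds: "0 \<le> odd_ratio n" "odd_ratio n \<le> 1"
  using even_return_pos[of n] odd_le_even_return[of n] nonneg[of \<one> "2 * n + 1"]
  by (auto simp: odd_ratio_def)

text \<open>
  \<open>T ^ (n + 2) \<delta> - T ^ n \<delta>\<close> is small compared to \<open>T ^ n \<delta>\<close>, because the even ratios tend to \<open>1\<close>.
  Pairing it with \<open>T ^ (n + 1) \<delta>\<close> shows that the odd ratio varies slowly.
\<close>

lemma odd_ratio_Suc_diff: "(\<lambda>n. odd_ratio (Suc n) - odd_ratio n) \<longlonglongrightarrow> 0"
proof -
  let ?A = "\<lambda>n. a (2 * n) \<one>" and ?B = "\<lambda>n. a (2 * n + 1) \<one>"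
  define d where "d = (\<lambda>n. odd_ratio (Suc n) * even_ratio n - odd_ratio n)"
  define e where "e = (\<lambda>n. even_ratio n * (even_ratio n * even_ratio (Suc n) - 2 * even_ratio n + 1))"
  have de: "(d n)\<^sup>2 \<le> e n" for n
  proof -
    have p: "?A n > 0" "?A (Suc n) > 0" by (rule even_return_pos)+
    have eqs: "2 * n + 3 = 2 * Suc n + 1" "2 * n + 2 = 2 * Suc n" "2 * n + 4 = 2 * Suc (Suc n)" by auto
    have "(?B (Suc n) - ?B n)\<^sup>2 \<le> ?A (Suc n) * (?A (Suc (Suc n)) - 2 * ?A (Suc n) + ?A n)"
      using return_two_step_gap[of n] unfolding eqs .
    then have "(?B (Suc n) - ?B n)\<^sup>2 / (?A n)\<^sup>2
        \<le> ?A (Suc n) * (?A (Suc (Suc n)) - 2 * ?A (Suc n) + ?A n) / (?A n)\<^sup>2"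
      by (intro divide_right_mono) auto
    moreover have "d n = (?B (Suc n) - ?B n) / ?A n"
      using p by (simp add: d_def odd_ratio_def even_ratio_def diff_divide_distrib)
    moreover have "e n = ?A (Suc n) * (?A (Suc (Suc n)) - 2 * ?A (Suc n) + ?A n) / (?A n)\<^sup>2"
    proof -
      have "even_ratio n * even_ratio (Suc n) = ?A (Suc (Suc n)) / ?A n"
        using p by (simp add: even_ratio_def)
      then have "even_ratio n * even_ratio (Suc n) - 2 * even_ratio n + 1
          = (?A (Suc (Suc n)) - 2 * ?A (Suc n) + ?A n) / ?A n"
        using p by (simp add: even_ratio_def add_divide_distrib diff_divide_distrib)
      then show ?thesis by (simp add: e_def even_ratio_def power2_eq_square)
    qed
    ultimately show ?thesis by (simp add: power_divide)
  qed
  have "e \<longlonglongrightarrow> 1 * (1 * 1 - 2 * 1 + 1)"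
    unfolding e_def by (intro tendsto_intros even_ratio_tendsto LIMSEQ_Suc[OF even_ratio_tendsto])
  then have "(\<lambda>n. (d n)\<^sup>2) \<longlonglongrightarrow> 0"
    using de tendsto_sandwich[of "\<lambda>_. 0" "\<lambda>n. (d n)\<^sup>2" sequentially e 0] by simp
  then have "(\<lambda>n. sqrt ((d n)\<^sup>2)) \<longlonglongrightarrow> sqrt 0" by (rule tendsto_real_sqrt)
  then have d: "d \<longlonglongrightarrow> 0" by (simp add: tendsto_rabs_zero_iff)
  have "(\<lambda>n. 1 - even_ratio n) \<longlonglongrightarrow> 1 - 1" by (intro tendsto_intros even_ratio_tendsto)
  then have z: "(\<lambda>n. \<bar>1 - even_ratio n\<bar>) \<longlonglongrightarrow> 0" by (simp add: tendsto_rabs_zero_iff)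
  have "(\<lambda>n. odd_ratio (Suc n) * (1 - even_ratio n)) \<longlonglongrightarrow> 0"
  proof (rule Lim_null_comparison[OF _ z])
    show "\<forall>\<^sub>F n in sequentially. norm (odd_ratio (Suc n) * (1 - even_ratio n)) \<le> \<bar>1 - even_ratio n\<bar>"
      using odd_ratio_bounds by (simp add: abs_mult mult_left_le_one_le)
  qed
  from tendsto_add[OF d this] show ?thesis by (simp add: d_def algebra_simps)
qed

lemma odd_ratio_shift_diff: "(\<lambda>n. odd_ratio (n + l) - odd_ratio n) \<longlonglongrightarrow> 0"
proof (induction l)
  case (Suc l)
  have "(\<lambda>n. (odd_ratio (Suc (n + l)) - odd_ratio (n + l)) + (odd_ratio (n + l) - odd_ratio n)) \<longlonglongrightarrow> 0 + 0"
    by (intro tendsto_add Suc LIMSEQ_ignore_initial_segment[OF odd_ratio_Suc_diff])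
  then show ?case by simp
qed simp

text \<open>
  The normalised spectral measure of \<open>T ^ n \<delta>\<close> has moments close to those of the measure with
  masses \<open>(1 + odd_ratio n) / 2\<close> at \<open>1\<close> and \<open>(1 - odd_ratio n) / 2\<close> at \<open>- 1\<close>. With \<open>\<tau> = 1\<close> this
  is the integral of \<open>(t ^ m - a m \<one>) ^ i\<close> against that measure, for odd \<open>m\<close>; with \<open>\<tau> = - 1\<close> it is
  the integral of \<open>t * (t ^ m - a m \<one>) ^ i\<close>.
\<close>

definition two_point :: "real \<Rightarrow> nat \<Rightarrow> nat \<Rightarrow> real" where
  "two_point \<tau> i n = ((1 + odd_ratio n) * (1 - a m \<one>) ^ i
      + \<tau> * (1 - odd_ratio n) * (- 1 - a m \<one>) ^ i) / 2"

lemma two_point_shift: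
  "(\<lambda>n. two_point \<tau> i (n + l) - two_point \<tau> i n) \<longlonglongrightarrow> 0"
proof -
  have "(\<lambda>n. (odd_ratio (n + l) - odd_ratio n) * (((1 - a m \<one>) ^ i - \<tau> * (- 1 - a m \<one>) ^ i) / 2)) \<longlonglongrightarrow> 0"
    by (rule tendsto_mult_left_zero[OF odd_ratio_shift_diff])
  moreover have "(odd_ratio (n + l) - odd_ratio n) * (((1 - a m \<one>) ^ i - \<tau> * (- 1 - a m \<one>) ^ i) / 2)
      = two_point \<tau> i (n + l) - two_point \<tau> i n" for n
    by (simp add: two_point_def field_simps)
  ultimately show ?thesis by (simp only:)
qed

lemma two_point_Bseq: "Bseq (two_point \<tau> i)"
proof (rule BseqI')
  fix n
  let ?p = "(1 - a m \<one>) ^ i" and ?q = "(- 1 - a m \<one>) ^ i"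
  have "norm (two_point \<tau> i n) \<le> (\<bar>(1 + odd_ratio n) * ?p\<bar> + \<bar>\<tau> * (1 - odd_ratio n) * ?q\<bar>) / 2"
    unfolding two_point_def by (simp add: abs_triangle_ineq)
  also have "\<dots> \<le> (2 * \<bar>?p\<bar> + \<bar>\<tau>\<bar> * 1 * \<bar>?q\<bar>) / 2"
    unfolding abs_mult using odd_ratio_bounds[of n]
    by (intro divide_right_mono add_mono mult_mono) auto
  finally show "norm (two_point \<tau> i n) \<le> (2 * \<bar>?p\<bar> + \<bar>\<tau>\<bar> * 1 * \<bar>?q\<bar>) / 2" .
qed

lemma two_point_Suc: "two_point \<tau> (Suc i) n = two_point (- \<tau>) i n - a m \<one> * two_point \<tau> i n"
  by (simp add: two_point_def field_simps)

lemma thinned_asymp: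
  "(\<lambda>n. thinned a m (a m \<one>) i (2 * n) \<one> / a (2 * n) \<one> - two_point 1 i n) \<longlonglongrightarrow> 0"
  "(\<lambda>n. thinned a m (a m \<one>) i (2 * n + 1) \<one> / a (2 * n) \<one> - two_point (- 1) i n) \<longlonglongrightarrow> 0"
proof (induction i)
  case 0
  show "(\<lambda>n. thinned a m (a m \<one>) 0 (2 * n) \<one> / a (2 * n) \<one> - two_point 1 0 n) \<longlonglongrightarrow> 0"
    using even_return_pos by (simp add: two_point_def less_imp_neq[symmetric])
  show "(\<lambda>n. thinned a m (a m \<one>) 0 (2 * n + 1) \<one> / a (2 * n) \<one> - two_point (- 1) 0 n) \<longlonglongrightarrow> 0"
    by (simp add: two_point_def odd_ratio_def)
next
  case (Suc i)
  let ?E = "thinned a m (a m \<one>)" and ?A = "\<lambda>n. a (2 * n) \<one>"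
  obtain l where l: "m = 2 * l + 1" using odd_m by (elim oddE)
  have shift: "(\<lambda>n. ?E i (2 * (n + k) + r) \<one> / ?A n - two_point \<tau> i n) \<longlonglongrightarrow> 0"
    if "(\<lambda>n. ?E i (2 * n + r) \<one> / ?A n - two_point \<tau> i n) \<longlonglongrightarrow> 0" for k r \<tau>
  proof -
    have "(\<lambda>n. (?E i (2 * (n + k) + r) \<one> / ?A (n + k) - two_point \<tau> i (n + k))
        + (two_point \<tau> i (n + k) - two_point \<tau> i n)) \<longlonglongrightarrow> 0 + 0"
      by (intro tendsto_add two_point_shift LIMSEQ_ignore_initial_segment[OF that])
    then have "(\<lambda>n. ?E i (2 * (n + k) + r) \<one> / ?A (n + k) - two_point \<tau> i n) \<longlonglongrightarrow> 0" by simp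
    then have "(\<lambda>n. ?E i (2 * (n + k) + r) \<one> / ?A (n + k) * (?A (n + k) / ?A n) - two_point \<tau> i n) \<longlonglongrightarrow> 0"
      by (rule tendsto_mult_diff_zero[OF _ two_point_Bseq even_shift_ratio_tendsto])
    moreover have "?E i (2 * (n + k) + r) \<one> / ?A (n + k) * (?A (n + k) / ?A n) = ?E i (2 * (n + k) + r) \<one> / ?A n" for n
      using even_return_pos[of "n + k"] by simp
    ultimately show ?thesis by (simp only:)
  qed
  have "(\<lambda>n. (?E i (2 * (n + l) + 1) \<one> / ?A n - two_point (- 1) i n)
      - a m \<one> * (?E i (2 * n) \<one> / ?A n - two_point 1 i n)) \<longlonglongrightarrow> 0 - a m \<one> * 0"
    by (intro tendsto_diff tendsto_mult tendsto_const Suc.IH(1) shift Suc.IH(2))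
  moreover have "(?E i (2 * (n + l) + 1) \<one> / ?A n - two_point (- 1) i n)
      - a m \<one> * (?E i (2 * n) \<one> / ?A n - two_point 1 i n)
      = ?E (Suc i) (2 * n) \<one> / ?A n - two_point 1 (Suc i) n" for n
  proof -
    have "2 * n + m = 2 * (n + l) + 1" by (simp add: l)
    then show ?thesis
      unfolding thinned.simps two_point_Suc diff_divide_distrib by (simp only:) (simp add: right_diff_distrib)
  qed
  ultimately show "(\<lambda>n. ?E (Suc i) (2 * n) \<one> / ?A n - two_point 1 (Suc i) n) \<longlonglongrightarrow> 0"
    by (simp only: mult_zero_right diff_0_right)
  have "(\<lambda>n. ?E i (2 * (n + (l + 1)) + 0) \<one> / ?A n - two_point 1 i n) \<longlonglongrightarrow> 0"
    by (rule shift) (use Suc.IH(1) in simp)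
  then have "(\<lambda>n. (?E i (2 * (n + (l + 1)) + 0) \<one> / ?A n - two_point 1 i n)
      - a m \<one> * (?E i (2 * n + 1) \<one> / ?A n - two_point (- 1) i n)) \<longlonglongrightarrow> 0 - a m \<one> * 0"
    by (intro tendsto_diff tendsto_mult tendsto_const Suc.IH(2))
  moreover have "(?E i (2 * (n + (l + 1)) + 0) \<one> / ?A n - two_point 1 i n)
      - a m \<one> * (?E i (2 * n + 1) \<one> / ?A n - two_point (- 1) i n)
      = ?E (Suc i) (2 * n + 1) \<one> / ?A n - two_point (- 1) (Suc i) n" for n
  proof -
    have "2 * n + 1 + m = 2 * (n + (l + 1)) + 0" by (simp add: l)
    then show ?thesis
      unfolding thinned.simps two_point_Suc diff_divide_distrib minus_minus
      by (simp only:) (simp add: right_diff_distrib)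
  qed
  ultimately show "(\<lambda>n. ?E (Suc i) (2 * n + 1) \<one> / ?A n - two_point (- 1) (Suc i) n) \<longlonglongrightarrow> 0"
    by (simp only: mult_zero_right diff_0_right)
qed

text \<open>
  The ratio limit theorem. For \<open>\<epsilon> = a m \<one>\<close> and odd \<open>i\<close> the integrals of \<open>(t ^ m - \<epsilon>) ^ i\<close> against
  the two-point measures are nonnegative up to \<open>o(1)\<close>. At \<open>t = - 1\<close> the integrand is
  \<open>- (1 + \<epsilon>) ^ i\<close>, at \<open>t = 1\<close> it is \<open>(1 - \<epsilon>) ^ i\<close>, so the mass at \<open>- 1\<close> is at most of the order of
  \<open>((1 - \<epsilon>) / (1 + \<epsilon>)) ^ i\<close>, and \<open>i\<close> is arbitrary.
\<close>

lemma odd_ratio_tendsto: "odd_ratio \<longlonglongrightarrow> 1"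
proof (rule tendstoI)
  fix \<delta> :: real assume \<delta>: "\<delta> > 0"
  define \<epsilon> where "\<epsilon> = a m \<one>"
  have \<epsilon>: "0 < \<epsilon>" "\<epsilon> \<le> 1" using return_m return_le_1[of m] by (auto simp: \<epsilon>_def)
  define q where "q = (1 - \<epsilon>) / (1 + \<epsilon>)"
  have q: "0 \<le> q" "q < 1" using \<epsilon> by (auto simp: q_def)
  obtain k where k: "q ^ k < \<delta> / 4" using real_arch_pow_inv[of "\<delta> / 4" q] \<delta> q by auto
  define i where "i = 2 * k + 1"
  have i: "odd i" by (simp add: i_def)
  have "q ^ i \<le> q ^ k" using q by (intro power_decreasing) (auto simp: i_def)
  with k have qi: "q ^ i < \<delta> / 4" by linarith
  have "\<forall>\<^sub>F n in sequentially. dist (thinned a m \<epsilon> i (2 * n) \<one> / a (2 * n) \<one> - two_point 1 i n) 0 < \<delta> / 4"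
    using tendstoD[OF thinned_asymp(1), of "\<delta> / 4"] \<delta> unfolding \<epsilon>_def by simp
  then show "\<forall>\<^sub>F n in sequentially. dist (odd_ratio n) 1 < \<delta>"
  proof eventually_elim
    case (elim n)
    have "thinned a m \<epsilon> i (2 * n) \<one> / a (2 * n) \<one> \<ge> 0"
      unfolding \<epsilon>_def using even_return_pos[of n] by (intro divide_nonneg_pos thinned_nonneg) auto
    moreover have "\<bar>thinned a m \<epsilon> i (2 * n) \<one> / a (2 * n) \<one> - two_point 1 i n\<bar> < \<delta> / 4"
      using elim by (simp add: dist_real_def)
    ultimately have "two_point 1 i n > - \<delta> / 4" by linarith
    moreover have "(- 1 - \<epsilon>) ^ i = - ((1 + \<epsilon>) ^ i)"
      using power_minus_odd[OF i, of "1 + \<epsilon>"] by simp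
    ultimately have "(1 - odd_ratio n) * (1 + \<epsilon>) ^ i < (1 + odd_ratio n) * (1 - \<epsilon>) ^ i + \<delta> / 2"
      by (simp add: two_point_def \<epsilon>_def)
    also have "(1 + odd_ratio n) * (1 - \<epsilon>) ^ i \<le> 2 * (1 - \<epsilon>) ^ i"
      using odd_ratio_bounds[of n] \<epsilon> by (intro mult_right_mono) auto
    also have "(1 - \<epsilon>) ^ i = q ^ i * (1 + \<epsilon>) ^ i"
      using \<epsilon> by (simp add: q_def power_divide)
    also have "\<delta> / 2 \<le> \<delta> / 2 * (1 + \<epsilon>) ^ i"
      using \<delta> \<epsilon> by (simp add: mult_le_cancel_left1)
    finally have "(1 - odd_ratio n) * (1 + \<epsilon>) ^ i < (2 * q ^ i + \<delta> / 2) * (1 + \<epsilon>) ^ i"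
      by (simp add: algebra_simps)
    then have "1 - odd_ratio n < 2 * q ^ i + \<delta> / 2"
      using \<epsilon> by (simp add: mult_less_cancel_right)
    then show ?case using qi odd_ratio_bounds[of n] by (simp add: dist_real_def)
  qed
qed

end

section \<open>From the generating function to the coefficients\<close>

text \<open>
  A perturbation of the coefficients that is small relative to \<open>c\<close> does not contribute to the
  leading singular behaviour at \<open>1\<close>.
\<close>

lemma power_series_small_o:
  fixes c e :: "nat \<Rightarrow> real"
  assumes \<beta>: "\<beta> > 0"
    and summ: "\<And>s. s \<in> {0<..<1} \<Longrightarrow> summable (\<lambda>n. c n * s ^ n)"
    and lim: "((\<lambda>s. (1 - s) powr \<beta> * (\<Sum>n. c n * s ^ n)) \<longlongrightarrow> K) (at_left 1)"
    and small: "\<And>\<eta>. \<eta> > 0 \<Longrightarrow> \<forall>\<^sub>F n in sequentially. \<bar>e n\<bar> \<le> \<eta> * c n"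
  shows "((\<lambda>s. (1 - s) powr \<beta> * (\<Sum>n. e n * s ^ n)) \<longlongrightarrow> 0) (at_left 1)"
proof (rule tendstoI)
  fix \<epsilon> :: real assume \<epsilon>: "\<epsilon> > 0"
  define \<eta> where "\<eta> = \<epsilon> / (2 * (\<bar>K\<bar> + 1))"
  have \<eta>: "\<eta> > 0" using \<epsilon> by (simp add: \<eta>_def)
  obtain N where N: "\<And>n. n \<ge> N \<Longrightarrow> \<bar>e n\<bar> \<le> \<eta> * c n"
    using small[OF \<eta>] unfolding eventually_sequentially by blast
  define B where "B = (\<Sum>n<N. \<bar>e n\<bar> + \<bar>\<eta> * c n\<bar>)"
  have z: "((\<lambda>s::real. (1 - s) powr \<beta>) \<longlongrightarrow> 0) (at_left 1)"
  proof -
    have "\<forall>\<^sub>F s::real in at_left 1. 0 \<le> 1 - s"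
      using eventually_at_left_real[of 0 "1::real"] by (rule eventually_mono) auto
    then have "((\<lambda>s::real. (1 - s) powr \<beta>) \<longlongrightarrow> (1 - 1) powr \<beta>) (at_left 1)"
      using \<beta> by (intro tendsto_powr2 tendsto_intros) auto
    then show ?thesis by simp
  qed
  have "((\<lambda>s. (1 - s) powr \<beta> * B + \<eta> * ((1 - s) powr \<beta> * (\<Sum>n. c n * s ^ n))) \<longlongrightarrow> 0 * B + \<eta> * K) (at_left 1)"
    by (intro tendsto_intros z lim)
  moreover have "0 * B + \<eta> * K < \<epsilon>"
  proof -
    have "\<eta> * K \<le> \<eta> * \<bar>K\<bar>" using \<eta> by simp
    also have "\<dots> < \<epsilon>" using \<epsilon> by (simp add: \<eta>_def field_simps add_nonneg_pos)
    finally show ?thesis by simp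
  qed
  ultimately have "\<forall>\<^sub>F s in at_left 1. (1 - s) powr \<beta> * B + \<eta> * ((1 - s) powr \<beta> * (\<Sum>n. c n * s ^ n)) < \<epsilon>"
    by (rule order_tendstoD)
  moreover have "\<forall>\<^sub>F s::real in at_left 1. s \<in> {0<..<1}" by (rule eventually_at_left_real) auto
  ultimately show "\<forall>\<^sub>F s in at_left 1. dist ((1 - s) powr \<beta> * (\<Sum>n. e n * s ^ n)) 0 < \<epsilon>"
  proof eventually_elim
    case (elim s)
    define f where "f = (\<lambda>n. if n < N then \<bar>e n\<bar> + \<bar>\<eta> * c n\<bar> else 0)"
    have f: "f sums B"
      unfolding f_def B_def using sums_If_finite_set[of "{..<N}" "\<lambda>n. \<bar>e n\<bar> + \<bar>\<eta> * c n\<bar>"] by simp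
    have g: "(\<lambda>n. f n + \<eta> * (c n * s ^ n)) sums (B + \<eta> * (\<Sum>n. c n * s ^ n))"
      by (intro sums_add f sums_mult summable_sums summ elim)
    have le: "\<bar>e n * s ^ n\<bar> \<le> f n + \<eta> * (c n * s ^ n)" for n
    proof (cases "n < N")
      case True
      have s: "0 \<le> s ^ n" "s ^ n \<le> 1" using elim(2) by (auto simp: power_le_one)
      have "\<bar>e n\<bar> * s ^ n \<le> \<bar>e n\<bar> * 1" using s by (intro mult_left_mono) auto
      moreover have "\<bar>\<eta> * c n\<bar> * s ^ n \<le> \<bar>\<eta> * c n\<bar> * 1" using s by (intro mult_left_mono) auto
      moreover have "- (\<bar>\<eta> * c n\<bar> * s ^ n) \<le> \<eta> * c n * s ^ n"
        using mult_right_mono[of "- \<bar>\<eta> * c n\<bar>" "\<eta> * c n" "s ^ n"] s by simp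
      ultimately have "\<bar>e n\<bar> * s ^ n \<le> \<bar>e n\<bar> + \<bar>\<eta> * c n\<bar> + \<eta> * c n * s ^ n"
        by linarith
      then show ?thesis using True s by (simp add: f_def abs_mult mult.assoc)
    next
      case False
      then have "\<bar>e n\<bar> * s ^ n \<le> \<eta> * c n * s ^ n"
        using N[of n] elim(2) by (intro mult_right_mono) auto
      then show ?thesis using False elim(2) by (simp add: f_def abs_mult mult.assoc)
    qed
    have sa: "summable (\<lambda>n. \<bar>e n * s ^ n\<bar>)"
      by (rule summable_comparison_test'[OF sums_summable[OF g], of 0]) (use le in auto)
    have "\<bar>\<Sum>n. e n * s ^ n\<bar> \<le> (\<Sum>n. \<bar>e n * s ^ n\<bar>)" by (rule summable_rabs[OF sa])
    also have "\<dots> \<le> B + \<eta> * (\<Sum>n. c n * s ^ n)"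
      unfolding sums_unique[OF g] by (rule suminf_le[OF le sa sums_summable[OF g]])
    finally have "(1 - s) powr \<beta> * \<bar>\<Sum>n. e n * s ^ n\<bar> \<le> (1 - s) powr \<beta> * (B + \<eta> * (\<Sum>n. c n * s ^ n))"
      by (intro mult_left_mono) auto
    with elim(1) show ?case by (simp add: abs_mult algebra_simps)
  qed
qed

lemma (in symmetric_convolution) le_sqrt_return:
  assumes "x \<in> carrier G"
  shows "(a (i + j) x)\<^sup>2 \<le> a (i + i) \<one> * a (j + j) \<one>"
  by (rule has_sum_Cauchy_Schwarz[OF pairing_one cross_pairing[OF assms] shifted_pairing[OF assms]])

lemma (in symmetric_convolution) le_1_if_return_le_1:
  assumes ret: "\<And>n. a n \<one> \<le> 1" and x: "x \<in> carrier G"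
  shows "a n x \<le> 1"
proof -
  have "(a (0 + n) x)\<^sup>2 \<le> a (0 + 0) \<one> * a (n + n) \<one>" by (rule le_sqrt_return[OF x])
  also have "\<dots> \<le> 1 * 1" by (intro mult_mono ret nonneg) auto
  finally show ?thesis using power2_le_imp_le[of "a n x" 1] by simp
qed

context aperiodic_convolution
begin

lemma parity_gap_small:
  assumes x: "x \<in> carrier G"
  shows "(\<lambda>n. (a (2 * (n div 2)) x - a n x) / a (2 * (n div 2)) \<one>) \<longlonglongrightarrow> 0"
proof -
  define g where "g = (\<lambda>k. (a (2 * k) x - a (2 * k + 1) x) / a (2 * k) \<one>)"
  define e where "e = (\<lambda>k. 1 - 2 * odd_ratio k + even_ratio k)"
  have ge: "(g k)\<^sup>2 \<le> e k" for k
  proof -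
    have p: "a (2 * k) \<one> > 0" by (rule even_return_pos)
    have "(g k)\<^sup>2 \<le> a (2 * k) \<one> * (a (2 * k) \<one> - 2 * a (2 * k + 1) \<one> + a (2 * k + 2) \<one>) / (a (2 * k) \<one>)\<^sup>2"
      unfolding g_def power_divide by (intro divide_right_mono parity_gap x) auto
    also have "\<dots> = e k"
      using p by (simp add: e_def odd_ratio_def even_ratio_def field_simps power2_eq_square)
    finally show ?thesis .
  qed
  have "e \<longlonglongrightarrow> 1 - 2 * 1 + 1"
    unfolding e_def by (intro tendsto_intros odd_ratio_tendsto even_ratio_tendsto)
  then have "(\<lambda>k. (g k)\<^sup>2) \<longlonglongrightarrow> 0"
    using ge tendsto_sandwich[of "\<lambda>_. 0" "\<lambda>k. (g k)\<^sup>2" sequentially e 0] by simp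
  then have "(\<lambda>k. sqrt ((g k)\<^sup>2)) \<longlonglongrightarrow> sqrt 0" by (rule tendsto_real_sqrt)
  then have "(\<lambda>k. \<bar>g k\<bar>) \<longlonglongrightarrow> 0" by simp
  moreover have "filterlim (\<lambda>n::nat. n div 2) sequentially sequentially"
    unfolding filterlim_at_top
  proof
    show "\<forall>\<^sub>F n in sequentially. Z \<le> n div 2" for Z :: nat
      using eventually_ge_at_top[of "2 * Z"] by eventually_elim simp
  qed
  ultimately have "(\<lambda>n. \<bar>g (n div 2)\<bar>) \<longlonglongrightarrow> 0" by (rule filterlim_compose)
  then show ?thesis
  proof (rule Lim_null_comparison[rotated])
    show "\<forall>\<^sub>F n in sequentially. norm ((a (2 * (n div 2)) x - a n x) / a (2 * (n div 2)) \<one>) \<le> \<bar>g (n div 2)\<bar>"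
    proof (intro always_eventually allI)
      fix n
      show "norm ((a (2 * (n div 2)) x - a n x) / a (2 * (n div 2)) \<one>) \<le> \<bar>g (n div 2)\<bar>"
      proof (cases "even n")
        case False
        then have "n = 2 * (n div 2) + 1" by simp
        then show ?thesis by (simp add: g_def)
      qed simp
    qed
  qed
qed

text \<open>
  The return sequence itself need not be monotone. Replacing the time \<open>n\<close> by the even time
  \<open>2 * (n div 2)\<close> changes the coefficients by \<open>o(a n \<one>)\<close> and makes the combinations of \<open>a n \<one>\<close> with
  \<open>a n x\<close>, with signs \<open>1\<close> and \<open>- 1\<close>, monotone. The Tauberian theorem applies to both, and half of
  their difference is, up to the same error, the coefficient in question.
\<close>

theorem coefficient_asymptotics:
  assumes \<beta>: "\<beta> > 0" and x: "x \<in> carrier G"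
    and lim1: "((\<lambda>s. (1 - s) powr \<beta> * (\<Sum>n. real n * a n \<one> * s ^ n)) \<longlongrightarrow> K) (at_left 1)"
    and limx: "((\<lambda>s. (1 - s) powr \<beta> * (\<Sum>n. real n * a n x * s ^ n)) \<longlongrightarrow> L) (at_left 1)"
  shows "(\<lambda>n. a n x * real n powr (2 - \<beta>)) \<longlonglongrightarrow> L / Gamma \<beta>"
proof -
  let ?b = "\<lambda>n. a (2 * (n div 2)) \<one>" and ?bx = "\<lambda>n. a (2 * (n div 2)) x"
  note le1 = le_1_if_return_le_1[OF return_le_1]
  have summb: "summable (\<lambda>n. real n * a (k n) y * s ^ n)" if "y \<in> carrier G" "s \<in> {0<..<1}" for k y s
  proof -
    have "summable (\<lambda>n. real n * s ^ n)"
      using sum_of_nat_power[of s] that(2) by (auto simp: sums_iff)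
    then have "summable (\<lambda>n. real n * s ^ n * a (k n) y)"
      by (rule summable_mult_bounded[where B = 1]) (use that le1 nonneg in auto)
    then show ?thesis by (simp add: mult_ac)
  qed
  note summ = summb[of _ _ "\<lambda>n. n"]
  have D_lim: "(\<lambda>n. (?b n + \<sigma> * ?bx n) * real n powr (2 - \<beta>)) \<longlonglongrightarrow> (K + \<sigma> * L) / Gamma \<beta>"
    if \<sigma>: "\<sigma> * \<sigma> = 1" for \<sigma>
  proof (rule monotone_tauberian[OF \<beta>])
    show "0 \<le> ?b n + \<sigma> * ?bx n" for n
      using polar_nonneg[OF x \<sigma>, of "n div 2"] by (simp only: mult_2)
    show "decseq (\<lambda>n. ?b n + \<sigma> * ?bx n)"
      unfolding decseq_def using decseqD[OF polar_decseq[OF x \<sigma>]] by (simp add: div_le_mono)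
    define e where "e = (\<lambda>n. real n * ((?b n - a n \<one>) + \<sigma> * (?bx n - a n x)))"
    have "((\<lambda>s. (1 - s) powr \<beta> * (\<Sum>n. e n * s ^ n)) \<longlongrightarrow> 0) (at_left 1)"
    proof (rule power_series_small_o[OF \<beta> summ[OF one_closed] lim1])
      fix \<eta> :: real assume \<eta>: "\<eta> > 0"
      have 1: "(\<lambda>n. (?b n - a n \<one>) / ?b n) \<longlonglongrightarrow> 0" by (rule parity_gap_small) simp
      have "(\<lambda>n. (?b n - a n \<one>) / ?b n + \<sigma> * ((?bx n - a n x) / ?b n)) \<longlonglongrightarrow> 0 + \<sigma> * 0"
        by (intro tendsto_intros 1 parity_gap_small[OF x])
      then have "\<forall>\<^sub>F n in sequentially. \<bar>(?b n - a n \<one>) / ?b n + \<sigma> * ((?bx n - a n x) / ?b n)\<bar> < \<eta> / 2"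
        unfolding add_0_right mult_zero_right
        by (rule order_tendstoD(2)[OF tendsto_rabs_zero]) (use \<eta> in simp)
      moreover have "\<forall>\<^sub>F n in sequentially. (?b n - a n \<one>) / ?b n < 1 / 2"
        using order_tendstoD(2)[OF 1, of "1 / 2"] by simp
      ultimately show "\<forall>\<^sub>F n in sequentially. \<bar>e n\<bar> \<le> \<eta> * (real n * a n \<one>)"
      proof eventually_elim
        case (elim n)
        have b: "?b n > 0" by (rule even_return_pos)
        have "(?b n - a n \<one>) / ?b n + \<sigma> * ((?bx n - a n x) / ?b n)
            = ((?b n - a n \<one>) + \<sigma> * (?bx n - a n x)) / ?b n"
          by (simp add: add_divide_distrib)
        then have "\<bar>(?b n - a n \<one>) + \<sigma> * (?bx n - a n x)\<bar> < \<eta> / 2 * ?b n"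
          using elim(1) b by (simp add: pos_divide_less_eq)
        moreover have "?b n < 2 * a n \<one>" using elim(2) b by (simp add: pos_divide_less_eq)
        then have "\<eta> / 2 * ?b n \<le> \<eta> / 2 * (2 * a n \<one>)" using \<eta> by (intro mult_left_mono) auto
        ultimately have "\<bar>(?b n - a n \<one>) + \<sigma> * (?bx n - a n x)\<bar> \<le> \<eta> * a n \<one>" by simp
        then have "real n * \<bar>(?b n - a n \<one>) + \<sigma> * (?bx n - a n x)\<bar> \<le> real n * (\<eta> * a n \<one>)"
          by (intro mult_left_mono) auto
        then show ?case by (simp add: e_def abs_mult mult_ac)
      qed
    qed
    then have "((\<lambda>s. (1 - s) powr \<beta> * (\<Sum>n. real n * a n \<one> * s ^ n)
        + \<sigma> * ((1 - s) powr \<beta> * (\<Sum>n. real n * a n x * s ^ n))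
        + (1 - s) powr \<beta> * (\<Sum>n. e n * s ^ n)) \<longlongrightarrow> K + \<sigma> * L + 0) (at_left 1)"
      by (intro tendsto_intros lim1 limx)
    moreover have "\<forall>\<^sub>F s::real in at_left 1. s \<in> {0<..<1}" by (rule eventually_at_left_real) auto
    then have "\<forall>\<^sub>F s in at_left 1. (1 - s) powr \<beta> * (\<Sum>n. real n * a n \<one> * s ^ n)
        + \<sigma> * ((1 - s) powr \<beta> * (\<Sum>n. real n * a n x * s ^ n))
        + (1 - s) powr \<beta> * (\<Sum>n. e n * s ^ n)
        = (1 - s) powr \<beta> * (\<Sum>n. real n * (?b n + \<sigma> * ?bx n) * s ^ n)"
    proof eventually_elim
      case (elim s)
      have eq: "e n * s ^ n = (real n * ?b n * s ^ n - real n * a n \<one> * s ^ n)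
          + \<sigma> * (real n * ?bx n * s ^ n - real n * a n x * s ^ n)" for n
        by (simp add: e_def algebra_simps)
      have se: "summable (\<lambda>n. e n * s ^ n)"
        unfolding eq using elim x
        by (intro summable_add summable_mult summable_diff summb) auto
      have s1: "summable (\<lambda>n. real n * a n \<one> * s ^ n)" and sx: "summable (\<lambda>n. real n * a n x * s ^ n)"
        using summ elim x by auto
      have "(\<lambda>n. real n * a n \<one> * s ^ n + \<sigma> * (real n * a n x * s ^ n) + e n * s ^ n)
          sums ((\<Sum>n. real n * a n \<one> * s ^ n) + \<sigma> * (\<Sum>n. real n * a n x * s ^ n) + (\<Sum>n. e n * s ^ n))"
        by (intro sums_add sums_mult summable_sums s1 sx se)
      moreover have "real n * a n \<one> * s ^ n + \<sigma> * (real n * a n x * s ^ n) + e n * s ^ n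
          = real n * (?b n + \<sigma> * ?bx n) * s ^ n" for n
        by (simp add: e_def algebra_simps)
      ultimately have "(\<Sum>n. real n * (?b n + \<sigma> * ?bx n) * s ^ n)
          = (\<Sum>n. real n * a n \<one> * s ^ n) + \<sigma> * (\<Sum>n. real n * a n x * s ^ n) + (\<Sum>n. e n * s ^ n)"
        by (simp only: sums_iff)
      then show ?case by (simp only: distrib_left mult.left_commute[of \<sigma>])
    qed
    ultimately show "((\<lambda>s. (1 - s) powr \<beta> * (\<Sum>n. real n * (?b n + \<sigma> * ?bx n) * s ^ n)) \<longlongrightarrow> K + \<sigma> * L) (at_left 1)"
      by (simp only: add_0_right) (rule Lim_transform_eventually)
  qed
  have "(\<lambda>n. ((?b n + 1 * ?bx n) * real n powr (2 - \<beta>) - (?b n + (- 1) * ?bx n) * real n powr (2 - \<beta>)) / 2)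
      \<longlonglongrightarrow> ((K + 1 * L) / Gamma \<beta> - (K + (- 1) * L) / Gamma \<beta>) / 2"
    by (intro tendsto_divide tendsto_diff D_lim tendsto_const) auto
  moreover have "((K + 1 * L) / Gamma \<beta> - (K + (- 1) * L) / Gamma \<beta>) / 2 = L / Gamma \<beta>"
    by (simp add: add_divide_distrib diff_divide_distrib)
  moreover have "((?b n + 1 * ?bx n) * real n powr (2 - \<beta>) - (?b n + (- 1) * ?bx n) * real n powr (2 - \<beta>)) / 2
      = ?bx n * real n powr (2 - \<beta>)" for n
    by (simp add: algebra_simps)
  ultimately have bx: "(\<lambda>n. ?bx n * real n powr (2 - \<beta>)) \<longlonglongrightarrow> L / Gamma \<beta>" by (simp only:)
  have "(\<lambda>n. ((?b n + 1 * ?bx n) * real n powr (2 - \<beta>) + (?b n + (- 1) * ?bx n) * real n powr (2 - \<beta>)) / 2)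
      \<longlonglongrightarrow> ((K + 1 * L) / Gamma \<beta> + (K + (- 1) * L) / Gamma \<beta>) / 2"
    by (intro tendsto_divide tendsto_add D_lim tendsto_const) auto
  moreover have "((?b n + 1 * ?bx n) * real n powr (2 - \<beta>) + (?b n + (- 1) * ?bx n) * real n powr (2 - \<beta>)) / 2
      = ?b n * real n powr (2 - \<beta>)" for n
    by (simp add: algebra_simps)
  ultimately have b: "(\<lambda>n. ?b n * real n powr (2 - \<beta>)) \<longlonglongrightarrow> ((K + 1 * L) / Gamma \<beta> + (K + (- 1) * L) / Gamma \<beta>) / 2"
    by (simp only:)
  have "(\<lambda>n. ?bx n * real n powr (2 - \<beta>) - (?bx n - a n x) / ?b n * (?b n * real n powr (2 - \<beta>)))
      \<longlonglongrightarrow> L / Gamma \<beta> - 0 * (((K + 1 * L) / Gamma \<beta> + (K + (- 1) * L) / Gamma \<beta>) / 2)"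
    by (intro tendsto_diff tendsto_mult bx b parity_gap_small[OF x])
  moreover have "?bx n * real n powr (2 - \<beta>) - (?bx n - a n x) / ?b n * (?b n * real n powr (2 - \<beta>))
      = a n x * real n powr (2 - \<beta>)" for n
    using even_return_pos[of "n div 2"] by (simp add: field_simps)
  ultimately show ?thesis by (simp only: mult_zero_left diff_0_right)
qed

end

section \<open>Transition probabilities of the walk\<close>

text \<open>
  Countable additivity over an arbitrary countable index set, as an unordered sum of reals.
\<close>

lemma (in finite_measure) has_sum_measure_UN:
  assumes X: "\<And>i. i \<in> I \<Longrightarrow> X i \<in> sets M" and I: "countable I" and disj: "disjoint_family_on X I"
  shows "((\<lambda>i. measure M (X i)) has_sum measure M (\<Union>i\<in>I. X i)) I"
proof -
  define Y where "Y = (\<lambda>n. if n \<in> to_nat_on I ` I then X (from_nat_into I n) else {})"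
  have Y_to: "Y (to_nat_on I i) = X i" if "i \<in> I" for i
    using that I by (simp add: Y_def)
  have UN: "(\<Union>n. Y n) = (\<Union>i\<in>I. X i)"
    using I by (auto simp: Y_def)
  have "(\<lambda>n. measure M (Y n)) sums measure M (\<Union>n. Y n)"
  proof (rule finite_measure_UNION)
    show "range Y \<subseteq> sets M" using X I by (auto simp: Y_def)
    show "disjoint_family Y"
      using disj I unfolding disjoint_family_on_def Y_def by (auto split: if_splits) fastforce
  qed
  then have "((\<lambda>n. measure M (Y n)) has_sum measure M (\<Union>i\<in>I. X i)) UNIV"
    unfolding UN by (intro sums_nonneg_imp_has_sum) auto
  also have "?this \<longleftrightarrow> ((\<lambda>n. measure M (Y n)) has_sum measure M (\<Union>i\<in>I. X i)) (to_nat_on I ` I)"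
    by (rule has_sum_cong_neutral) (auto simp: Y_def)
  also have "\<dots> \<longleftrightarrow> ((\<lambda>i. measure M (X i)) has_sum measure M (\<Union>i\<in>I. X i)) I"
    using I by (subst has_sum_reindex) (auto simp: o_def Y_to cong: has_sum_cong)
  finally show ?thesis .
qed

context random_walk
begin

text \<open>
  \<open>kernel n g\<close> is the probability that the walk started at \<open>\<one>\<close> is at \<open>g\<close> at time \<open>n\<close>; left
  translation reduces all transition probabilities to it.
\<close>

abbreviation step_prob :: "'a \<Rightarrow> real" where "step_prob g \<equiv> measure (step_law \<Gamma> M \<xi>) {g}"
abbreviation kernel :: "nat \<Rightarrow> 'a \<Rightarrow> real" where "kernel n g \<equiv> trans_prob \<Gamma> M \<xi> n \<one> g"

lemma increment_measurable: "i \<ge> 1 \<Longrightarrow> \<xi> i \<in> measurable M (count_space (carrier \<Gamma>))"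
  using indep_increments by (auto simp: indep_vars_def2)

lemma increment_prob:
  assumes "i \<ge> 1" "g \<in> carrier \<Gamma>"
  shows "prob (\<xi> i -` {g} \<inter> space M) = step_prob g"
proof -
  have "measure (distr M (count_space (carrier \<Gamma>)) (\<xi> i)) {g} = prob (\<xi> i -` {g} \<inter> space M)"
    using assms increment_measurable by (intro measure_distr) auto
  then show ?thesis using identically_distributed[OF assms(1)] by (simp add: step_law_def)
qed

text \<open>
  The walk up to time \<open>N\<close> is a measurable function of the vector of the first \<open>N\<close> increments. Here
  \<^const>\<open>walk\<close> is applied to the coordinate maps of the product space in place of the increments.
\<close>

lemma walk_path_measurable:
  assumes "x \<in> carrier \<Gamma>" "n \<le> N"
  shows "walk \<Gamma> (\<lambda>i f. f i) x n \<in> measurable (PiM {1..N} (\<lambda>_. count_space (carrier \<Gamma>))) (count_space (carrier \<Gamma>))"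
  using assms(2)
proof (induction n)
  case 0
  have "walk \<Gamma> (\<lambda>i f. f i) x 0 = (\<lambda>_. x)" by (simp add: fun_eq_iff)
  then show ?case using assms(1) by simp
next
  case (Suc n)
  let ?P = "PiM {1..N} (\<lambda>_. count_space (carrier \<Gamma>))"
  have c: "(\<lambda>f. f (Suc n)) \<in> measurable ?P (count_space (carrier \<Gamma>))"
    using Suc.prems by (intro measurable_component_singleton) auto
  have "(\<lambda>f. h \<otimes> f (Suc n)) \<in> measurable ?P (count_space (carrier \<Gamma>))" if "h \<in> carrier \<Gamma>" for h
    by (rule measurable_compose[OF c]) (use that in auto)
  then have "(\<lambda>f. walk \<Gamma> (\<lambda>i f. f i) x n f \<otimes> f (Suc n)) \<in> measurable ?P (count_space (carrier \<Gamma>))"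
    by (rule measurable_compose_countable'[OF _ _ countable_carrier]) (use Suc in auto)
  moreover have "walk \<Gamma> (\<lambda>i f. f i) x (Suc n) = (\<lambda>f. walk \<Gamma> (\<lambda>i f. f i) x n f \<otimes> f (Suc n))"
    by (simp add: fun_eq_iff)
  ultimately show ?case by simp
qed

lemma walk_restrict:
  "n \<le> N \<Longrightarrow> walk \<Gamma> (\<lambda>i f. f i) x n (restrict (\<lambda>i. \<xi> i \<omega>) {1..N}) = walk \<Gamma> \<xi> x n \<omega>"
  by (induction n) auto

lemma walk_increment_indep:
  assumes x: "x \<in> carrier \<Gamma>"
  shows "indep_var (count_space (carrier \<Gamma>)) (walk \<Gamma> \<xi> x n) (count_space (carrier \<Gamma>)) (\<xi> (Suc n))"
proof -
  let ?C = "\<lambda>_::nat. count_space (carrier \<Gamma>)"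
  have "indep_var (PiM {1..n} ?C) (\<lambda>\<omega>. restrict (\<lambda>i. \<xi> i \<omega>) {1..n})
      (PiM {Suc n} ?C) (\<lambda>\<omega>. restrict (\<lambda>i. \<xi> i \<omega>) {Suc n})"
    by (rule indep_var_restrict[OF indep_increments]) auto
  then have "indep_var (count_space (carrier \<Gamma>)) (walk \<Gamma> (\<lambda>i f. f i) x n \<circ> (\<lambda>\<omega>. restrict (\<lambda>i. \<xi> i \<omega>) {1..n}))
      (count_space (carrier \<Gamma>)) ((\<lambda>f. f (Suc n)) \<circ> (\<lambda>\<omega>. restrict (\<lambda>i. \<xi> i \<omega>) {Suc n}))"
    by (rule indep_var_compose) (rule walk_path_measurable[OF x order.refl], rule measurable_component_singleton, simp)
  moreover have "walk \<Gamma> (\<lambda>i f. f i) x n \<circ> (\<lambda>\<omega>. restrict (\<lambda>i. \<xi> i \<omega>) {1..n}) = walk \<Gamma> \<xi> x n"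
    using walk_restrict[of n n x] by (simp add: fun_eq_iff)
  moreover have "(\<lambda>f. f (Suc n)) \<circ> (\<lambda>\<omega>. restrict (\<lambda>i. \<xi> i \<omega>) {Suc n}) = \<xi> (Suc n)"
    by (simp add: fun_eq_iff)
  ultimately show ?thesis by simp
qed

lemma walk_measurable:
  "x \<in> carrier \<Gamma> \<Longrightarrow> walk \<Gamma> \<xi> x n \<in> measurable M (count_space (carrier \<Gamma>))"
  using walk_increment_indep indep_var_rv1 by blast

lemma walk_in_carrier: "x \<in> carrier \<Gamma> \<Longrightarrow> \<omega> \<in> space M \<Longrightarrow> walk \<Gamma> \<xi> x n \<omega> \<in> carrier \<Gamma>"
  using measurable_space[OF walk_measurable] by simp

lemma increment_in_carrier: "i \<ge> 1 \<Longrightarrow> \<omega> \<in> space M \<Longrightarrow> \<xi> i \<omega> \<in> carrier \<Gamma>"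
  using measurable_space[OF increment_measurable] by simp

lemma trans_prob_translate:
  assumes x: "x \<in> carrier \<Gamma>" and y: "y \<in> carrier \<Gamma>"
  shows "trans_prob \<Gamma> M \<xi> n x y = kernel n (inv x \<otimes> y)"
proof -
  have shift: "walk \<Gamma> \<xi> x n \<omega> = x \<otimes> walk \<Gamma> \<xi> \<one> n \<omega>" if \<omega>: "\<omega> \<in> space M" for \<omega>
  proof (induction n)
    case (Suc n)
    then show ?case
      using x walk_in_carrier[OF one_closed \<omega>, of n] increment_in_carrier[OF _ \<omega>, of "Suc n"]
      by (simp add: m_assoc)
  qed (use x in simp)
  have "walk \<Gamma> \<xi> x n \<omega> = y \<longleftrightarrow> walk \<Gamma> \<xi> \<one> n \<omega> = inv x \<otimes> y" if \<omega>: "\<omega> \<in> space M" for \<omega>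
    using shift[OF \<omega>] x y walk_in_carrier[OF one_closed \<omega>, of n] inv_solve_left[of "walk \<Gamma> \<xi> \<one> n \<omega>" x y]
    by (auto simp: eq_commute)
  then have "{\<omega> \<in> space M. walk \<Gamma> \<xi> x n \<omega> = y} = {\<omega> \<in> space M. walk \<Gamma> \<xi> \<one> n \<omega> = inv x \<otimes> y}"
    by auto
  then show ?thesis by (simp add: trans_prob_def)
qed

lemma kernel_0: "kernel 0 g = (if g = \<one> then 1 else 0)"
  by (auto simp: trans_prob_def prob_space)

lemma kernel_Suc:
  assumes g: "g \<in> carrier \<Gamma>"
  shows "((\<lambda>h. kernel n h * step_prob (inv h \<otimes> g)) has_sum kernel (Suc n) g) (carrier \<Gamma>)"
proof -
  let ?X = "\<lambda>h. (\<lambda>\<omega>. (walk \<Gamma> \<xi> \<one> n \<omega>, \<xi> (Suc n) \<omega>)) -` ({h} \<times> {inv h \<otimes> g}) \<inter> space M"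
  have prob_X: "prob (?X h) = kernel n h * step_prob (inv h \<otimes> g)" if h: "h \<in> carrier \<Gamma>" for h
  proof -
    have "prob (?X h) = prob (walk \<Gamma> \<xi> \<one> n -` {h} \<inter> space M) * prob (\<xi> (Suc n) -` {inv h \<otimes> g} \<inter> space M)"
      using h g by (intro indep_varD[OF walk_increment_indep]) auto
    also have "walk \<Gamma> \<xi> \<one> n -` {h} \<inter> space M = {\<omega> \<in> space M. walk \<Gamma> \<xi> \<one> n \<omega> = h}" by auto
    finally show ?thesis using h g by (simp add: increment_prob trans_prob_def)
  qed
  have "((\<lambda>h. prob (?X h)) has_sum prob (\<Union>h\<in>carrier \<Gamma>. ?X h)) (carrier \<Gamma>)"
  proof (rule has_sum_measure_UN[OF _ countable_carrier])
    fix h assume h: "h \<in> carrier \<Gamma>"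
    have "?X h = (walk \<Gamma> \<xi> \<one> n -` {h} \<inter> space M) \<inter> (\<xi> (Suc n) -` {inv h \<otimes> g} \<inter> space M)" by auto
    also have "\<dots> \<in> sets M"
      using h g by (intro sets.Int measurable_sets[OF walk_measurable] measurable_sets[OF increment_measurable]) auto
    finally show "?X h \<in> sets M" .
  qed (auto simp: disjoint_family_on_def)
  also have "(\<Union>h\<in>carrier \<Gamma>. ?X h) = {\<omega> \<in> space M. walk \<Gamma> \<xi> \<one> (Suc n) \<omega> = g}"
  proof (intro Set.set_eqI iffI)
    fix \<omega> assume "\<omega> \<in> (\<Union>h\<in>carrier \<Gamma>. ?X h)"
    then show "\<omega> \<in> {\<omega> \<in> space M. walk \<Gamma> \<xi> \<one> (Suc n) \<omega> = g}"
      using g by (auto simp flip: m_assoc)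
  next
    fix \<omega> assume "\<omega> \<in> {\<omega> \<in> space M. walk \<Gamma> \<xi> \<one> (Suc n) \<omega> = g}"
    then have \<omega>: "\<omega> \<in> space M" and eq: "walk \<Gamma> \<xi> \<one> n \<omega> \<otimes> \<xi> (Suc n) \<omega> = g" by auto
    have "walk \<Gamma> \<xi> \<one> n \<omega> \<in> carrier \<Gamma>" "\<xi> (Suc n) \<omega> \<in> carrier \<Gamma>"
      using \<omega> walk_in_carrier increment_in_carrier by auto
    then show "\<omega> \<in> (\<Union>h\<in>carrier \<Gamma>. ?X h)"
      using \<omega> by (auto simp: eq[symmetric] simp flip: m_assoc)
  qed
  also have "prob \<dots> = kernel (Suc n) g" by (simp only: trans_prob_def)
  finally show ?thesis
    using prob_X by (simp cong: has_sum_cong)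
qed

lemma kernel_1: "g \<in> carrier \<Gamma> \<Longrightarrow> kernel 1 g = step_prob g"
proof -
  assume g: "g \<in> carrier \<Gamma>"
  have "((\<lambda>h. kernel 0 h * step_prob (inv h \<otimes> g)) has_sum step_prob g) (carrier \<Gamma>)
      \<longleftrightarrow> ((\<lambda>h. kernel 0 h * step_prob (inv h \<otimes> g)) has_sum step_prob g) {\<one>}"
    by (rule has_sum_cong_neutral) (auto simp: kernel_0)
  moreover have "((\<lambda>h. kernel 0 h * step_prob (inv h \<otimes> g)) has_sum step_prob g) {\<one>}"
    using g by (intro has_sum_finiteI) (auto simp: kernel_0)
  ultimately show ?thesis using has_sum_unique[OF kernel_Suc[OF g, of 0]] by simp
qed

lemma kernel_nonneg: "kernel n g \<ge> 0"
  by (simp add: trans_prob_def)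

lemma kernel_convolution:
  assumes "x \<in> carrier \<Gamma>"
  shows "((\<lambda>y. kernel i y * kernel j (inv y \<otimes> x)) has_sum kernel (i + j) x) (carrier \<Gamma>)"
  using assms
proof (induction j arbitrary: x)
  case 0
  have z: "kernel 0 (inv y \<otimes> x) = (if y = x then 1 else 0)" if "y \<in> carrier \<Gamma>" for y
    using inv_solve_left[of \<one> y x] that 0 by (auto simp: kernel_0)
  have "((\<lambda>y. kernel i y * kernel 0 (inv y \<otimes> x)) has_sum kernel i x) (carrier \<Gamma>)
      \<longleftrightarrow> ((\<lambda>y. kernel i y * kernel 0 (inv y \<otimes> x)) has_sum kernel i x) {x}"
    using 0 by (intro has_sum_cong_neutral) (auto simp: z)
  moreover have "((\<lambda>y. kernel i y * kernel 0 (inv y \<otimes> x)) has_sum kernel i x) {x}"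
    using 0 by (intro has_sum_finiteI) (auto simp: z kernel_0)
  ultimately show ?case by simp
next
  case (Suc j)
  define F where "F = (\<lambda>(z, y). kernel i y * kernel j (inv y \<otimes> z) * step_prob (inv z \<otimes> x))"
  have inner: "((\<lambda>y. F (z, y)) has_sum kernel (i + j) z * step_prob (inv z \<otimes> x)) (carrier \<Gamma>)"
    if "z \<in> carrier \<Gamma>" for z
    unfolding F_def prod.case by (rule has_sum_cmult_left[OF Suc.IH[OF that]])
  have outer: "((\<lambda>z. kernel (i + j) z * step_prob (inv z \<otimes> x)) has_sum kernel (i + Suc j) x) (carrier \<Gamma>)"
    using kernel_Suc[OF Suc.prems, of "i + j"] by simp
  have "F summable_on carrier \<Gamma> \<times> carrier \<Gamma>"
    using inner has_sum_imp_summable[OF outer]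
    by (rule summable_on_SigmaI) (auto simp: F_def kernel_nonneg)
  with inner outer have "(F has_sum kernel (i + Suc j) x) (carrier \<Gamma> \<times> carrier \<Gamma>)"
    by (rule has_sum_SigmaI)
  then have "((\<lambda>(y, z). F (z, y)) has_sum kernel (i + Suc j) x) (carrier \<Gamma> \<times> carrier \<Gamma>)"
    by (subst (asm) has_sum_swap)
  then show ?case
  proof (rule has_sum_SigmaD)
    fix y assume y: "y \<in> carrier \<Gamma>"
    have "((\<lambda>u. kernel j u * step_prob (inv u \<otimes> (inv y \<otimes> x))) has_sum kernel (Suc j) (inv y \<otimes> x)) (carrier \<Gamma>)"
      using y Suc.prems by (intro kernel_Suc) auto
    also have "?this \<longleftrightarrow> ((\<lambda>z. kernel j (inv y \<otimes> z) * step_prob (inv z \<otimes> x)) has_sum kernel (Suc j) (inv y \<otimes> x)) (carrier \<Gamma>)"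
    proof (rule has_sum_reindex_bij_witness[of _ "\<lambda>z. inv y \<otimes> z" "\<lambda>u. y \<otimes> u"])
      fix u assume u: "u \<in> carrier \<Gamma>"
      have "inv (y \<otimes> u) \<otimes> x = inv u \<otimes> (inv y \<otimes> x)"
        using y u Suc.prems by (simp add: inv_mult_group m_assoc)
      moreover have "inv y \<otimes> (y \<otimes> u) = u" using y u by (simp flip: m_assoc)
      ultimately show "kernel j (inv y \<otimes> (y \<otimes> u)) * step_prob (inv (y \<otimes> u) \<otimes> x) = kernel j u * step_prob (inv u \<otimes> (inv y \<otimes> x))"
        by simp
    qed (use y in \<open>auto simp flip: m_assoc\<close>)
    finally have "((\<lambda>z. kernel i y * (kernel j (inv y \<otimes> z) * step_prob (inv z \<otimes> x)))
        has_sum kernel i y * kernel (Suc j) (inv y \<otimes> x)) (carrier \<Gamma>)"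
      by (rule has_sum_cmult_right)
    then show "((\<lambda>z. case (y, z) of (y, z) \<Rightarrow> F (z, y)) has_sum kernel i y * kernel (Suc j) (inv y \<otimes> x)) (carrier \<Gamma>)"
      by (simp add: F_def mult.assoc)
  qed
qed

lemma step_symmetric:
  assumes sym: "symmetric_walk \<Gamma> M \<xi>" and g: "g \<in> carrier \<Gamma>"
  shows "step_prob (inv g) = step_prob g"
proof -
  let ?C = "count_space (carrier \<Gamma>)"
  have "step_prob g = measure (distr (step_law \<Gamma> M \<xi>) ?C (m_inv \<Gamma>)) {g}"
    using sym by (simp add: symmetric_walk_def)
  also have "\<dots> = measure (step_law \<Gamma> M \<xi>) (m_inv \<Gamma> -` {g} \<inter> space (step_law \<Gamma> M \<xi>))"
    using g by (intro measure_distr) (auto simp: step_law_def)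
  also have "m_inv \<Gamma> -` {g} \<inter> space (step_law \<Gamma> M \<xi>) = {inv g}"
    using g by (auto simp: step_law_def)
  finally show ?thesis by simp
qed

lemma kernel_symmetric:
  assumes sym: "symmetric_walk \<Gamma> M \<xi>" and "g \<in> carrier \<Gamma>"
  shows "kernel n (inv g) = kernel n g"
  using assms(2)
proof (induction n arbitrary: g)
  case 0
  then show ?case by (simp add: kernel_0)
next
  case (Suc n)
  have "((\<lambda>h. kernel n h * step_prob (inv h \<otimes> inv g)) has_sum kernel (Suc n) (inv g)) (carrier \<Gamma>)"
    using Suc.prems by (intro kernel_Suc) auto
  also have "?this \<longleftrightarrow> ((\<lambda>k. kernel 1 k * kernel n (inv k \<otimes> g)) has_sum kernel (Suc n) (inv g)) (carrier \<Gamma>)"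
  proof (rule has_sum_reindex_bij_witness[of _ "\<lambda>k. inv g \<otimes> k" "\<lambda>h. g \<otimes> h"])
    fix h assume h: "h \<in> carrier \<Gamma>"
    have "inv h \<otimes> inv g = inv (g \<otimes> h)" using h Suc.prems by (simp add: inv_mult_group)
    then have "step_prob (inv h \<otimes> inv g) = kernel 1 (g \<otimes> h)"
      using step_symmetric[OF sym, of "g \<otimes> h"] kernel_1[of "g \<otimes> h"] h Suc.prems by simp
    moreover have "inv (g \<otimes> h) \<otimes> g = inv h"
      using h Suc.prems by (simp add: inv_mult_group m_assoc)
    then have "kernel n (inv (g \<otimes> h) \<otimes> g) = kernel n h" using Suc.IH[OF h] by simp
    ultimately show "kernel 1 (g \<otimes> h) * kernel n (inv (g \<otimes> h) \<otimes> g) = kernel n h * step_prob (inv h \<otimes> inv g)"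
      by simp
  qed (use Suc.prems in \<open>auto simp flip: m_assoc\<close>)
  finally show ?case
    using has_sum_unique[OF kernel_convolution[OF Suc.prems, of 1 n]] by simp
qed

lemma kernel_symmetric_convolution:
  assumes "symmetric_walk \<Gamma> M \<xi>" "r \<ge> 0"
  shows "symmetric_convolution \<Gamma> (\<lambda>n g. r ^ n * kernel n g)"
proof
  fix n i j x
  assume x: "x \<in> carrier \<Gamma>"
  show "0 \<le> r ^ n * kernel n x" using assms(2) by (simp add: kernel_nonneg)
  show "r ^ n * kernel n (inv x) = r ^ n * kernel n x"
    using kernel_symmetric[OF assms(1) x] by simp
  have "((\<lambda>y. r ^ (i + j) * (kernel i y * kernel j (inv y \<otimes> x))) has_sum r ^ (i + j) * kernel (i + j) x) (carrier \<Gamma>)"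
    by (rule has_sum_cmult_right[OF kernel_convolution[OF x]])
  then show "((\<lambda>y. r ^ i * kernel i y * (r ^ j * kernel j (inv y \<otimes> x))) has_sum r ^ (i + j) * kernel (i + j) x) (carrier \<Gamma>)"
    by (simp add: power_add mult_ac)
qed

end

section \<open>The radius of convergence and the asymptotics\<close>

text \<open>
  Supermultiplicativity of the return sequence: a term of size at least \<open>1\<close> in the power series
  would be followed by infinitely many others.
\<close>

lemma (in symmetric_convolution) return_times_power_less_1:
  assumes r: "r \<ge> 0" and n: "n \<ge> 1" and summ: "summable (\<lambda>k. a k \<one> * r ^ k)"
  shows "a n \<one> * r ^ n < 1"
proof (rule ccontr)
  assume "\<not> a n \<one> * r ^ n < 1"
  then have ge: "1 \<le> a n \<one> * r ^ n" by simp
  have big: "1 \<le> a (Suc k * n) \<one> * r ^ (Suc k * n)" for k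
  proof -
    have "1 \<le> (a n \<one> * r ^ n) ^ Suc k" using ge by (rule one_le_power)
    also have "\<dots> = (a n \<one>) ^ Suc k * r ^ (Suc k * n)"
      by (simp only: power_mult_distrib power_mult[symmetric] mult.commute[of n])
    also have "\<dots> \<le> a (Suc k * n) \<one> * r ^ (Suc k * n)"
      using r by (intro mult_right_mono return_power_le) auto
    finally show ?thesis .
  qed
  have "strict_mono (\<lambda>k. Suc k * n)" using n by (intro strict_monoI) simp
  then have "(\<lambda>k. a (Suc k * n) \<one> * r ^ (Suc k * n)) \<longlonglongrightarrow> 0"
    using LIMSEQ_subseq_LIMSEQ[OF summable_LIMSEQ_zero[OF summ]] by (simp add: o_def)
  then have "(1::real) \<le> 0" by (rule LIMSEQ_le_const) (use big in blast)
  then show False by simp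
qed

lemma deriv_power_series_scaled:
  fixes p :: "nat \<Rightarrow> real"
  assumes R: "R > 0" and bound: "\<And>n. \<bar>R ^ n * p n\<bar> \<le> 1" and s: "s \<in> {0<..<1}"
  shows "(\<Sum>n. real n * (R ^ n * p n) * s ^ n) = R * s * deriv (\<lambda>r. \<Sum>n. r ^ n * p n) (R * s)"
proof -
  define q where "q = (1 + s) / 2"
  have q: "s < q" "q < 1" using s by (auto simp: q_def)
  define K where "K = R * q"
  have K: "R * s < K" "0 < K" using R s q by (auto simp: K_def)
  have sK: "summable (\<lambda>n. p n * K ^ n)"
  proof (rule summable_comparison_test'[where N = 0])
    show "summable (\<lambda>n. q ^ n)" using q s by (intro summable_geometric) auto
    show "norm (p n * K ^ n) \<le> q ^ n" for n
      using mult_right_mono[OF bound[of n], of "q ^ n"] q s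
      by (simp add: K_def power_mult_distrib abs_mult mult_ac)
  qed
  have Rs: "norm (R * s) < norm K" using K R s by simp
  have "((\<lambda>r. \<Sum>n. p n * r ^ n) has_field_derivative (\<Sum>n. diffs p n * (R * s) ^ n)) (at (R * s))"
    by (rule termdiffs_strong[OF sK Rs])
  then have d: "deriv (\<lambda>r. \<Sum>n. r ^ n * p n) (R * s) = (\<Sum>n. diffs p n * (R * s) ^ n)"
    by (simp add: DERIV_imp_deriv mult.commute)
  have sd: "summable (\<lambda>n. diffs p n * (R * s) ^ n)"
    by (rule termdiff_converges[of _ K]) (use Rs K sK R s in \<open>auto intro: powser_inside\<close>)
  have "(\<lambda>n. (R * s) * (diffs p n * (R * s) ^ n)) sums ((R * s) * (\<Sum>n. diffs p n * (R * s) ^ n))"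
    by (intro sums_mult summable_sums sd)
  also have "(\<lambda>n. (R * s) * (diffs p n * (R * s) ^ n)) = (\<lambda>n. real (Suc n) * (R ^ Suc n * p (Suc n)) * s ^ Suc n)"
    by (simp add: diffs_def power_mult_distrib mult_ac fun_eq_iff)
  finally have "(\<lambda>n. real n * (R ^ n * p n) * s ^ n) sums ((R * s) * (\<Sum>n. diffs p n * (R * s) ^ n))"
    by (subst (asm) sums_Suc_iff) simp
  then show ?thesis unfolding d by (simp only: sums_iff)
qed

context random_walk
begin

lemma odd_return:
  assumes "aperiodic_walk \<Gamma> M \<xi>"
  shows "\<exists>m. odd m \<and> kernel m \<one> > 0"
proof (rule ccontr)
  assume "\<not> ?thesis"
  then have "2 dvd Gcd {n::nat. n \<ge> 1 \<and> kernel n \<one> > 0}"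
    by (intro Gcd_greatest) auto
  then show False using assms by (simp add: aperiodic_walk_def)
qed

lemma kernel_le_1: "kernel n g \<le> 1"
  by (simp add: trans_prob_def)

text \<open>
  The radius of convergence \<open>R\<close> is positive and finite, and the return probabilities are at most
  \<open>R ^ (- n)\<close>. This bound at the radius itself comes from the strict bound at smaller arguments.
\<close>

lemma green_radius_normalisation:
  assumes sym: "symmetric_walk \<Gamma> M \<xi>" and aper: "aperiodic_walk \<Gamma> M \<xi>"
  defines "R \<equiv> green_radius \<Gamma> M \<xi>"
  shows "R > 0" "R ^ n * kernel n \<one> \<le> 1"
proof -
  interpret S: symmetric_convolution \<Gamma> "\<lambda>n g. 1 ^ n * kernel n g"
    by (rule kernel_symmetric_convolution[OF sym]) simp
  let ?\<rho> = "conv_radius (\<lambda>n. kernel n \<one>)"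
  have less_1: "kernel n \<one> * r ^ n < 1" if "r \<ge> 0" "ereal r < ?\<rho>" "n \<ge> 1" for r n
    using S.return_times_power_less_1[OF that(1,3)] summable_in_conv_radius[of r "\<lambda>n. kernel n \<one>"] that
    by simp
  have "ereal (norm (1 / 2 :: real)) \<le> ?\<rho>"
  proof (rule conv_radius_geI, rule summable_comparison_test'[where N = 0])
    show "summable (\<lambda>n. (1 / 2 :: real) ^ n)" by (intro summable_geometric) auto
    show "norm (kernel n \<one> * (1 / 2) ^ n) \<le> (1 / 2) ^ n" for n
      using kernel_le_1[of n \<one>] kernel_nonneg[of n \<one>] by (simp add: abs_mult mult_left_le_one_le)
  qed
  then have half: "ereal (1 / 2) \<le> ?\<rho>" by simp
  obtain m where m: "odd m" "kernel m \<one> > 0" using odd_return[OF aper] by blast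
  have "?\<rho> \<noteq> \<infinity>"
  proof
    assume "?\<rho> = \<infinity>"
    define r where "r = 1 / kernel m \<one>"
    have m1: "m \<ge> 1" using m(1) by (cases m) auto
    \<comment> \<open>Already the term of index \<open>m\<close> is at least \<open>1\<close> at this argument.\<close>
    have r: "r \<ge> 1" using m(2) kernel_le_1[of m \<one>] by (simp add: r_def)
    have "kernel m \<one> * r ^ m < 1" using less_1[of r m] r \<open>?\<rho> = \<infinity>\<close> m1 by simp
    moreover have "r ^ 1 \<le> r ^ m" using r m1 by (intro power_increasing) auto
    then have "kernel m \<one> * r \<le> kernel m \<one> * r ^ m" using m(2) by simp
    moreover have "kernel m \<one> * r = 1" using m(2) by (simp add: r_def)
    ultimately show False by simp
  qed
  then have \<rho>: "?\<rho> = ereal R"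
    using half unfolding R_def green_radius_def by (cases ?\<rho>) auto
  show R: "R > 0" using half unfolding \<rho> by simp
  show "R ^ n * kernel n \<one> \<le> 1"
  proof (cases "n = 0")
    case False
    have "((\<lambda>r. kernel n \<one> * r ^ n) \<longlongrightarrow> kernel n \<one> * R ^ n) (at_left R)"
      by (intro tendsto_intros)
    then have "kernel n \<one> * R ^ n \<le> 1"
    proof (rule tendsto_upperbound)
      show "\<forall>\<^sub>F r in at_left R. kernel n \<one> * r ^ n \<le> 1"
        using eventually_at_left_real[OF R]
      proof eventually_elim
        case (elim r)
        then show ?case using less_1[of r n] False \<rho> by simp
      qed
    qed simp
    then show ?thesis by (simp add: mult.commute)
  qed (simp add: kernel_le_1)
qed

end

lemma not_summable_if_blow_up:
  fixes c :: "nat \<Rightarrow> real"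
  assumes \<beta>: "\<beta> > 0" and c: "\<And>n. c n \<ge> 0" and K: "K \<noteq> 0"
    and lim: "((\<lambda>s. (1 - s) powr \<beta> * (\<Sum>n. c n * s ^ n)) \<longlongrightarrow> K) (at_left 1)"
  shows "\<not> summable c"
proof
  assume summ: "summable c"
  have near: "\<forall>\<^sub>F s::real in at_left 1. s \<in> {0<..<1}" by (rule eventually_at_left_real) auto
  have "((\<lambda>s::real. (1 - s) powr \<beta>) \<longlongrightarrow> (1 - 1) powr \<beta>) (at_left 1)"
    using \<beta> near by (intro tendsto_powr2 tendsto_intros) (auto elim: eventually_mono)
  then have "((\<lambda>s::real. (1 - s) powr \<beta> * (\<Sum>n. c n)) \<longlongrightarrow> 0 * (\<Sum>n. c n)) (at_left 1)"
    by (intro tendsto_mult tendsto_const) simp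
  then have "((\<lambda>s::real. (1 - s) powr \<beta> * (\<Sum>n. c n)) \<longlongrightarrow> 0) (at_left 1)" by simp
  then have "((\<lambda>s. (1 - s) powr \<beta> * (\<Sum>n. c n * s ^ n)) \<longlongrightarrow> 0) (at_left 1)"
  proof (rule Lim_null_comparison[rotated])
    show "\<forall>\<^sub>F s in at_left 1. norm ((1 - s) powr \<beta> * (\<Sum>n. c n * s ^ n)) \<le> (1 - s) powr \<beta> * (\<Sum>n. c n)"
      using near
    proof eventually_elim
      case (elim s)
      have le: "c n * s ^ n \<le> c n" for n
        using elim c[of n] by (simp add: mult_left_le power_le_one)
      have nn: "0 \<le> c n * s ^ n" for n using elim c[of n] by simp
      have ss: "summable (\<lambda>n. c n * s ^ n)"
        by (rule summable_comparison_test'[OF summ, of 0]) (use le nn in simp)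
      have "0 \<le> (\<Sum>n. c n * s ^ n)" by (rule suminf_nonneg[OF ss nn])
      moreover have "(\<Sum>n. c n * s ^ n) \<le> (\<Sum>n. c n)" by (rule suminf_le[OF le ss summ])
      ultimately show ?case by (simp add: abs_mult mult_left_mono)
    qed
  qed
  then show False using tendsto_unique[OF _ lim] K by simp
qed

theorem theorem9p1:
  fixes \<Gamma> :: "('a, 'b) monoid_scheme"
    and M :: "'w measure"
    and \<xi> :: "nat \<Rightarrow> 'w \<Rightarrow> 'a"
    and R \<beta> :: real
  assumes walk: "random_walk \<Gamma> M \<xi>"
    and symmetric: "symmetric_walk \<Gamma> M \<xi>"
    and irreducible: "irreducible_walk \<Gamma> M \<xi>"
    and aperiodic: "aperiodic_walk \<Gamma> M \<xi>"
    and R: "R = green_radius \<Gamma> M \<xi>"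
    and \<beta>: "\<beta> > 0"
    and green_deriv: "\<forall>x\<in>carrier \<Gamma>. \<forall>y\<in>carrier \<Gamma>. \<exists>C>0.
      deriv (\<lambda>r. green \<Gamma> M \<xi> r x y) \<sim>[at_left R] (\<lambda>r. C / (R - r) powr \<beta>)"
  shows "\<exists>C' :: 'a \<Rightarrow> 'a \<Rightarrow> real. \<forall>x\<in>carrier \<Gamma>. \<forall>y\<in>carrier \<Gamma>. C' x y > 0 \<and>
      (\<lambda>n. trans_prob \<Gamma> M \<xi> n x y) \<sim>[at_top]
      (\<lambda>n. C' x y * R powi (- int n) * real n powr (\<beta> - 2))"
proof -
  interpret random_walk \<Gamma> M \<xi> by (rule walk)
  define a where "a = (\<lambda>n g. R ^ n * kernel n g)"
  have R0: "R > 0" and return_le_1: "\<And>n. a n \<one>\<^bsub>\<Gamma>\<^esub> \<le> 1"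
    unfolding a_def R by (rule green_radius_normalisation[OF symmetric aperiodic])+
  interpret S: symmetric_convolution \<Gamma> a
    unfolding a_def using R0 by (intro kernel_symmetric_convolution symmetric) simp
  have lim: "\<exists>L>0. ((\<lambda>s. (1 - s) powr \<beta> * (\<Sum>n. real n * a n g * s ^ n)) \<longlongrightarrow> L) (at_left 1)"
    if g: "g \<in> carrier \<Gamma>" for g
  proof -
    obtain C where C: "C > 0"
      and asymp: "deriv (\<lambda>r. green \<Gamma> M \<xi> r \<one>\<^bsub>\<Gamma>\<^esub> g) \<sim>[at_left R] (\<lambda>r. C / (R - r) powr \<beta>)"
      using green_deriv g by blast
    \<comment> \<open>The substitution \<open>r = R * s\<close> moves the singularity to \<open>s = 1\<close>; differentiating the Green's
      function termwise brings down the factor \<open>n\<close>.\<close>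
    define D where "D = deriv (\<lambda>r. green \<Gamma> M \<xi> r \<one>\<^bsub>\<Gamma>\<^esub> g)"
    have nearR: "\<forall>\<^sub>F r in at_left R. r \<in> {0<..<R}" by (rule eventually_at_left_real[OF R0])
    have "((\<lambda>r. D r / (C / (R - r) powr \<beta>)) \<longlongrightarrow> 1) (at_left R)"
      unfolding D_def using asymp
      by (rule asymp_equivD_strong) (use nearR C in \<open>auto elim: eventually_mono\<close>)
    moreover have "filterlim (\<lambda>s. R * s) (at_left R) (at_left 1)"
    proof (rule filterlim_at_withinI)
      have "((\<lambda>s. R * s) \<longlongrightarrow> R * 1) (at_left 1)" by (intro tendsto_intros)
      then show "((\<lambda>s. R * s) \<longlongrightarrow> R) (at_left 1)" by simp
      have "\<forall>\<^sub>F s::real in at_left 1. s \<in> {0<..<1}" by (rule eventually_at_left_real) auto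
      then show "\<forall>\<^sub>F s in at_left 1. R * s \<in> {..<R} - {R}"
        by eventually_elim (use R0 in auto)
    qed
    ultimately have "((\<lambda>s. D (R * s) / (C / (R - R * s) powr \<beta>)) \<longlongrightarrow> 1) (at_left 1)"
      by (rule filterlim_compose)
    then have "((\<lambda>s. R * s * C / R powr \<beta> * (D (R * s) / (C / (R - R * s) powr \<beta>)))
        \<longlongrightarrow> R * 1 * C / R powr \<beta> * 1) (at_left 1)"
      using R0 by (intro tendsto_intros) auto
    moreover have "\<forall>\<^sub>F s::real in at_left 1. s \<in> {0<..<1}" by (rule eventually_at_left_real) auto
    then have "\<forall>\<^sub>F s in at_left 1. R * s * C / R powr \<beta> * (D (R * s) / (C / (R - R * s) powr \<beta>))
        = (1 - s) powr \<beta> * (\<Sum>n. real n * a n g * s ^ n)"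
    proof eventually_elim
      case (elim s)
      have "\<bar>R ^ n * kernel n g\<bar> \<le> 1" for n
        using S.le_1_if_return_le_1[OF return_le_1 g, of n] S.nonneg[OF g, of n] by (simp add: a_def)
      from deriv_power_series_scaled[OF R0 this elim]
      have "(\<Sum>n. real n * a n g * s ^ n) = R * s * D (R * s)"
        by (simp add: a_def D_def green_def[abs_def])
      moreover have "(R - R * s) powr \<beta> = R powr \<beta> * (1 - s) powr \<beta>"
        using R0 elim powr_mult[of R "1 - s" \<beta>] by (simp add: right_diff_distrib)
      ultimately show ?case using R0 C elim by (simp add: field_simps)
    qed
    ultimately have "((\<lambda>s. (1 - s) powr \<beta> * (\<Sum>n. real n * a n g * s ^ n)) \<longlongrightarrow> R * 1 * C / R powr \<beta> * 1) (at_left 1)"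
      by (rule Lim_transform_eventually)
    then show ?thesis using R0 C by (intro exI[of _ "R * 1 * C / R powr \<beta> * 1"]) simp
  qed
  then have "\<exists>L. \<forall>g\<in>carrier \<Gamma>. L g > 0 \<and>
      ((\<lambda>s. (1 - s) powr \<beta> * (\<Sum>n. real n * a n g * s ^ n)) \<longlongrightarrow> L g) (at_left 1)"
    by (intro bchoice ballI)
  then obtain L where L: "\<And>g. g \<in> carrier \<Gamma> \<Longrightarrow> L g > 0"
    and L_lim: "\<And>g. g \<in> carrier \<Gamma> \<Longrightarrow>
      ((\<lambda>s. (1 - s) powr \<beta> * (\<Sum>n. real n * a n g * s ^ n)) \<longlongrightarrow> L g) (at_left 1)"
    by blast
  obtain m where m: "odd m" "kernel m \<one>\<^bsub>\<Gamma>\<^esub> > 0" using odd_return[OF aperiodic] by blast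
  interpret A: aperiodic_convolution \<Gamma> a m
  proof
    show "a n \<one>\<^bsub>\<Gamma>\<^esub> \<le> 1" for n by (rule return_le_1)
    show "odd m" "a m \<one>\<^bsub>\<Gamma>\<^esub> > 0" using m R0 by (auto simp: a_def)
    show "\<not> summable (\<lambda>n. real n * a n \<one>\<^bsub>\<Gamma>\<^esub>)"
      by (rule not_summable_if_blow_up[OF \<beta> _ _ L_lim[OF one_closed]])
        (use L[OF one_closed] S.nonneg[OF one_closed] in auto)
  qed
  define C' where "C' = (\<lambda>x y. L (inv\<^bsub>\<Gamma>\<^esub> x \<otimes>\<^bsub>\<Gamma>\<^esub> y) / Gamma \<beta>)"
  show ?thesis
  proof (intro exI[of _ C'] ballI conjI)
    fix x y assume x: "x \<in> carrier \<Gamma>" and y: "y \<in> carrier \<Gamma>"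
    define g where "g = inv\<^bsub>\<Gamma>\<^esub> x \<otimes>\<^bsub>\<Gamma>\<^esub> y"
    have g: "g \<in> carrier \<Gamma>" using x y by (simp add: g_def)
    have C': "C' x y = L g / Gamma \<beta>" by (simp add: C'_def g_def)
    show pos: "C' x y > 0" unfolding C' using L[OF g] Gamma_real_pos[OF \<beta>] by simp
    have "(\<lambda>n. a n g * real n powr (2 - \<beta>)) \<longlonglongrightarrow> C' x y"
      unfolding C' by (rule A.coefficient_asymptotics[OF \<beta> g L_lim[OF one_closed] L_lim[OF g]])
    then have "(\<lambda>n. a n g * real n powr (2 - \<beta>) / C' x y) \<longlonglongrightarrow> C' x y / C' x y"
      using pos by (intro tendsto_intros) auto
    moreover have "\<forall>\<^sub>F n in sequentially. a n g * real n powr (2 - \<beta>) / C' x y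
        = trans_prob \<Gamma> M \<xi> n x y / (C' x y * R powi (- int n) * real n powr (\<beta> - 2))"
      using eventually_gt_at_top[of 0]
    proof eventually_elim
      case (elim n)
      have p1: "real n powr (2 - \<beta>) = inverse (real n powr (\<beta> - 2))"
        by (simp flip: powr_minus)
      have p2: "R powi (- int n) = inverse (R ^ n)"
        by (simp add: power_int_minus)
      show ?case
        unfolding p1 p2 trans_prob_translate[OF x y] a_def g_def by (simp add: divide_inverse mult_ac)
    qed
    ultimately have "(\<lambda>n. trans_prob \<Gamma> M \<xi> n x y / (C' x y * R powi (- int n) * real n powr (\<beta> - 2)))
        \<longlonglongrightarrow> C' x y / C' x y"
      by (rule Lim_transform_eventually)
    then show "(\<lambda>n. trans_prob \<Gamma> M \<xi> n x y) \<sim>[at_top] (\<lambda>n. C' x y * R powi (- int n) * real n powr (\<beta> - 2))"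
      using pos by (intro asymp_equivI') simp
  qed
qed

end
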